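(* Let $\Omega\subset\mathbb{R}^2$ be the unit disk centered at $0$. Let $\partial\Omega_1,\partial\Omega_2\subset\partial\Omega$ be two arcs with disjoint closures, $\partial\Omega_i$ ($i=1,2$) being parameterized by $x(t)=(\cos t,\sin t)$, $t\in(s_i-\varepsilon_i,s_i+\varepsilon_i)$, with $\varepsilon_i>0$. Assume that there is a constant $c_0>0$ such that $|x(s_1)-x(s_2)|\ge c_0$. Let $\partial\Omega_a=\partial\Omega_1\cup\partial\Omega_2$, $\partial\Omega_r=\partial\Omega\setminus\overline{\partial\Omega_a}$, and let $u$ be the solution of $$\Delta u=-1\ \text{in }\Omega,\qquad u=0\ \text{on }\partial\Omega_a,\qquad \frac{\partial u}{\partial\nu}=0\ \text{on }\partial\Omega_r .$$ Then, as $\varepsilon_1,\varepsilon_2\to0$, $$u(x)=\frac{(\ln|x(s_1)-x(s_2)|)^2-\ln\frac{\varepsilon_1}{2}\,\ln\frac{\varepsilon_2}{2}}{\ln\frac{\varepsilon_1\varepsilon_2}{4|x(s_1)-x(s_2)|^2}}+\frac14(1-|x|^2)+\frac{\ln\frac{\varepsilon_2}{2|x(s_1)-x(s_2)|}}{\ln\frac{\varepsilon_1\varepsilon_2}{4|x(s_1)-x(s_2)|^2}}\ln|x-x(s_1)|+\frac{\ln\frac{\varepsilon_1}{2|x(s_1)-x(s_2)|}}{\ln\frac{\varepsilon_1\varepsilon_2}{4|x(s_1)-x(s_2)|^2}}\ln|x-x(s_2)|+O\big(\sqrt{\varepsilon_1^2+\varepsilon_2^2}\big),$$ where $O(\sqrt{\varepsilon_1^2+\varepsilon_2^2})$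 is uniform in $x\in\Omega$ satisfying $\mathrm{dist}(x,\partial\Omega_1\cup\partial\Omega_2)\ge c$ for some constant $c>0$.
   Context: $\nu$ denotes the outward unit normal on $\partial\Omega$. The asymptotics is for $\varepsilon_1,\varepsilon_2\to0$ with $c_0$ and $c$ fixed. *)

theory Defs
  imports "HOL-Analysis.Analysis"
begin

definition partial_deriv :: "'a::euclidean_space \<Rightarrow> ('a \<Rightarrow> real) \<Rightarrow> 'a \<Rightarrow> real" where
  "partial_deriv b f x = frechet_derivative f (at x) b"

text \<open>\<open>C1_on\<close> and \<open>C2_on\<close> are meant for open sets \<open>S\<close>.\<close>

definition C1_on :: "'a::euclidean_space set \<Rightarrow> ('a \<Rightarrow> real) \<Rightarrow> bool" where
  "C1_on S f \<longleftrightarrow> (\<forall>x\<in>S. f differentiable (at x)) \<and> (\<forall>b\<in>Basis. continuous_on S (partial_deriv b f))"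

definition C2_on :: "'a::euclidean_space set \<Rightarrow> ('a \<Rightarrow> real) \<Rightarrow> bool" where
  "C2_on S f \<longleftrightarrow> C1_on S f \<and> (\<forall>b\<in>Basis. C1_on S (partial_deriv b f))"

definition laplacian :: "('a::euclidean_space \<Rightarrow> real) \<Rightarrow> 'a \<Rightarrow> real" where
  "laplacian f x = (\<Sum>b\<in>Basis. partial_deriv b (partial_deriv b f) x)"

text \<open>Derivative in the direction of the outward normal \<open>v\<close> at a boundary point \<open>x\<close>, taken from
  inside the domain: only \<open>h \<le> 0\<close> is used, so values of \<open>u\<close> outside the closed domain are irrelevant.\<close>

definition has_normal_deriv ::
  "('a::real_normed_vector \<Rightarrow> real) \<Rightarrow> 'a \<Rightarrow> real \<Rightarrow> 'a \<Rightarrow> bool" where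
  "has_normal_deriv u v D x \<longleftrightarrow>
     ((\<lambda>h. u (x + h *\<^sub>R v)) has_real_derivative D) (at 0 within {..0})"

definition unit_disk :: "(real^2) set" where
  "unit_disk = ball 0 1"

definition circle_pt :: "real \<Rightarrow> real^2" where
  "circle_pt t = vector [cos t, sin t]"

definition boundary_arc :: "real \<Rightarrow> real \<Rightarrow> (real^2) set" where
  "boundary_arc s \<epsilon> = circle_pt ` {s - \<epsilon> <..< s + \<epsilon>}"

text \<open>Classical solutions of the mixed problem, with absorbing part \<open>A\<close> of the unit circle and
  reflecting part \<open>frontier unit_disk - closure A\<close>. The outward unit normal at a point \<open>x\<close> of the unit
  circle is \<open>x\<close> itself. Continuity on the whole closed disk, including the end points of the arcs,
  is part of the notion of solution; without it, solutions are not unique.\<close>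

definition mixed_bvp_solution :: "(real^2) set \<Rightarrow> (real^2 \<Rightarrow> real) \<Rightarrow> bool" where
  "mixed_bvp_solution A u \<longleftrightarrow>
     continuous_on (closure unit_disk) u \<and>
     C2_on unit_disk u \<and>
     (\<forall>x\<in>unit_disk. laplacian u x = - 1) \<and>
     (\<forall>x\<in>A. u x = 0) \<and>
     (\<forall>x\<in>frontier unit_disk - closure A. has_normal_deriv u x 0 x)"

end

theory Submission
  imports Defs "HOL-Complex_Analysis.Cauchy_Integral_Formula"
begin

text \<open>
  Identify the plane with the complex numbers. For the arc of half-angle \<open>\<epsilon>\<close> around \<open>1\<close> put
  \<open>g(z) = 1 - z + sqrt (1 - z e\<^sup>i\<^sup>\<epsilon>) sqrt (1 - z e\<^sup>-\<^sup>i\<^sup>\<epsilon>)\<close>. Then \<open>ln |g|\<close> is harmonic in the disk,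
  equals the constant \<open>ln (2 sin (\<epsilon>/2))\<close> on the arc, and has normal derivative exactly \<open>1/2\<close> on the
  rest of the circle, because \<open>z g'(z)/g(z) = 1/2 - (1 + z)/(2 s(z))\<close>, where \<open>s\<close> is the product of the
  two roots and \<open>((1 + z)/s(z))\<^sup>2\<close> is real and nonpositive there. Away from the arc it differs from
  \<open>ln (2 |1 - z|)\<close> by \<open>O(\<epsilon>\<^sup>2)\<close>.

  A combination of the two rotated potentials whose weights sum to \<open>1\<close>, plus a constant and
  \<open>(1 - |z|\<^sup>2)/4\<close>, satisfies the equation and the Neumann condition exactly; weights and constant are
  chosen so that its values on the arcs are \<open>O(\<epsilon>\<^sub>1 + \<epsilon>\<^sub>2)\<close>. The maximum principle for the mixed problem
  bounds the difference to \<open>u\<close> by its size on the arcs.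
\<close>

subsection \<open>The Laplacian along lines and the maximum principle\<close>

text \<open>A relation rather than a derivative operator: it serves both Frechet partial derivatives
  and derivatives of holomorphic functions, and asks for the first derivative only near 0.\<close>

definition has_deriv2_at_0 :: "(real \<Rightarrow> real) \<Rightarrow> real \<Rightarrow> bool" where
  "has_deriv2_at_0 g q \<longleftrightarrow> (\<exists>g'. (\<forall>\<^sub>F h in nhds 0. (g has_real_derivative g' h) (at h)) \<and>
     (g' has_real_derivative q) (at 0))"

lemma has_deriv2_at_0_add:
  assumes "has_deriv2_at_0 f p" "has_deriv2_at_0 g q"
  shows "has_deriv2_at_0 (\<lambda>h. f h + g h) (p + q)"
proof -
  obtain f' g' where
    "\<forall>\<^sub>F h in nhds 0. (f has_real_derivative f' h) (at h)" "(f' has_real_derivative p) (at 0)"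
    "\<forall>\<^sub>F h in nhds 0. (g has_real_derivative g' h) (at h)" "(g' has_real_derivative q) (at 0)"
    using assms unfolding has_deriv2_at_0_def by blast
  then show ?thesis
    unfolding has_deriv2_at_0_def
    by (intro exI[of _ "\<lambda>h. f' h + g' h"] conjI DERIV_add)
       (auto elim: eventually_elim2 intro: DERIV_add)
qed

lemma has_deriv2_at_0_cmult:
  assumes "has_deriv2_at_0 f p"
  shows "has_deriv2_at_0 (\<lambda>h. c * f h) (c * p)"
proof -
  obtain f' where
    "\<forall>\<^sub>F h in nhds 0. (f has_real_derivative f' h) (at h)" "(f' has_real_derivative p) (at 0)"
    using assms unfolding has_deriv2_at_0_def by blast
  then show ?thesis
    unfolding has_deriv2_at_0_def
    by (intro exI[of _ "\<lambda>h. c * f' h"] conjI DERIV_cmult)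
       (auto elim: eventually_mono intro: DERIV_cmult)
qed

text \<open>If \<open>q > 0\<close>, the first derivative vanishes at 0 and is positive just to the
  right of it, so the mean value theorem produces a value above the maximum.\<close>

lemma has_deriv2_at_0_le_0_if_max:
  assumes "has_deriv2_at_0 g q" and "\<forall>\<^sub>F h in nhds 0. g h \<le> g 0"
  shows "q \<le> 0"
proof (rule ccontr)
  assume "\<not> q \<le> 0"
  obtain g' where g': "\<forall>\<^sub>F h in nhds 0. (g has_real_derivative g' h) (at h)"
      "(g' has_real_derivative q) (at 0)"
    using assms(1) unfolding has_deriv2_at_0_def by blast
  from eventually_conj[OF assms(2) g'(1)] obtain d where d: "d > 0"
    "\<And>h. \<bar>h\<bar> < d \<Longrightarrow> g h \<le> g 0 \<and> (g has_real_derivative g' h) (at h)"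
    unfolding eventually_nhds_metric by (auto simp: dist_real_def)
  have "g' 0 = 0"
    by (rule DERIV_local_max[of g _ 0 d]) (use d in auto)
  obtain k where k: "k > 0" "\<And>h. 0 < h \<Longrightarrow> h < k \<Longrightarrow> g' 0 < g' h"
    using DERIV_pos_inc_right[OF g'(2)] \<open>\<not> q \<le> 0\<close> by auto
  define h where "h = min d k / 2"
  have h: "0 < h" "h < d" "h < k" using d(1) k(1) by (auto simp: h_def)
  obtain t where t: "0 < t" "t < h" "g h - g 0 = (h - 0) * g' t"
    using MVT2[of 0 h g g'] h d(2) by force
  have "g' t > 0" using k(2)[of t] t h \<open>g' 0 = 0\<close> by auto
  then have "h * g' t > 0" using h(1) by simp
  then have "g h > g 0" using t(3) by simp
  then show False using d(2)[of h] h by auto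
qed

text \<open>Both directions are written as multiples of a complex unit, \<open>1\<close> and
  \<open>\<i>\<close>, so that facts proved for a general direction \<open>d\<close> apply to
  each.\<close>

definition has_laplacian_at :: "(complex \<Rightarrow> real) \<Rightarrow> complex \<Rightarrow> real \<Rightarrow> bool" where
  "has_laplacian_at f z L \<longleftrightarrow> (\<exists>p q. has_deriv2_at_0 (\<lambda>h. f (z + of_real h * 1)) p \<and>
     has_deriv2_at_0 (\<lambda>h. f (z + of_real h * \<i>)) q \<and> L = p + q)"

lemma has_laplacian_at_add:
  assumes "has_laplacian_at f z L" "has_laplacian_at g z M"
  shows "has_laplacian_at (\<lambda>z. f z + g z) z (L + M)"
proof -
  obtain p q p' q' where *: "has_deriv2_at_0 (\<lambda>h. f (z + of_real h * 1)) p"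
     "has_deriv2_at_0 (\<lambda>h. f (z + of_real h * \<i>)) q" "L = p + q"
     "has_deriv2_at_0 (\<lambda>h. g (z + of_real h * 1)) p'"
     "has_deriv2_at_0 (\<lambda>h. g (z + of_real h * \<i>)) q'" "M = p' + q'"
    using assms unfolding has_laplacian_at_def by blast
  show ?thesis unfolding has_laplacian_at_def
    by (intro exI[of _ "p + p'"] exI[of _ "q + q'"] conjI)
       (use has_deriv2_at_0_add[OF *(1,4)] has_deriv2_at_0_add[OF *(2,5)] *(3,6) in simp_all)
qed

lemma has_laplacian_at_cmult:
  assumes "has_laplacian_at f z L"
  shows "has_laplacian_at (\<lambda>z. c * f z) z (c * L)"
proof -
  obtain p q where *: "has_deriv2_at_0 (\<lambda>h. f (z + of_real h * 1)) p"
     "has_deriv2_at_0 (\<lambda>h. f (z + of_real h * \<i>)) q" "L = p + q"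
    using assms unfolding has_laplacian_at_def by blast
  show ?thesis unfolding has_laplacian_at_def
    by (intro exI[of _ "c * p"] exI[of _ "c * q"] conjI)
       (use has_deriv2_at_0_cmult[OF *(1)] has_deriv2_at_0_cmult[OF *(2)] *(3)
        in \<open>simp_all add: distrib_left\<close>)
qed

lemma has_laplacian_at_cmod_square: "has_laplacian_at (\<lambda>z. (cmod z)\<^sup>2) z 4"
  unfolding has_laplacian_at_def has_deriv2_at_0_def
  by (rule exI[of _ 2], rule exI[of _ 2], intro conjI,
      rule exI[of _ "\<lambda>h. 2 * (Re z + h)"])
     (auto simp: cmod_power2 intro!: exI[of _ "\<lambda>h. 2 * (Im z + h)"] always_eventually
       derivative_eq_intros)

lemma has_laplacian_at_const: "has_laplacian_at (\<lambda>z. c) z 0"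
  unfolding has_laplacian_at_def has_deriv2_at_0_def
  by (intro exI[of _ 0] exI[of _ "\<lambda>h. 0"]) (auto intro!: exI[of _ "\<lambda>h. 0"])

lemma has_real_derivative_Re_along_line:
  assumes "(G has_field_derivative G') (at (z + of_real h * d))"
  shows "((\<lambda>t. Re (G (z + of_real t * d))) has_real_derivative Re (d * G')) (at h)"
proof -
  have "((\<lambda>t. z + of_real t * d) has_vector_derivative d) (at h)"
    by (auto intro!: derivative_eq_intros)
  from field_vector_diff_chain_at[OF this assms]
  have "((\<lambda>t. G (z + of_real t * d)) has_vector_derivative d * G') (at h)"
    by (simp add: o_def)
  then show ?thesis
    unfolding has_real_derivative_iff_has_vector_derivative
    by (rule bounded_linear.has_vector_derivative[OF bounded_linear_Re])
qed

text \<open>The second derivative of \<open>Re G\<close> in direction \<open>d\<close> is the real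
  part of \<open>d\<^sup>2\<close> times the second complex derivative of \<open>G\<close>, and the
  squares of 1 and \<open>\<i>\<close> sum to 0.\<close>

lemma has_laplacian_at_Re_holomorphic:
  assumes "G holomorphic_on S" "open S" "z \<in> S"
  shows "has_laplacian_at (\<lambda>z. Re (G z)) z 0"
proof -
  have 1: "(G has_field_derivative deriv G w) (at w)" if "w \<in> S" for w
    using assms that by (meson holomorphic_derivI)
  have 2: "(deriv G has_field_derivative deriv (deriv G) z) (at z)"
    using assms by (meson holomorphic_derivI holomorphic_deriv)
  have *: "has_deriv2_at_0 (\<lambda>h. Re (G (z + of_real h * d))) (Re (d * (d * deriv (deriv G) z)))"
    for d
  proof -
    have "((\<lambda>h. z + of_real h * d) \<longlongrightarrow> z + of_real 0 * d) (nhds 0)"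
      by (intro tendsto_intros filterlim_ident)
    then have "\<forall>\<^sub>F h in nhds 0. z + of_real h * d \<in> S"
      using assms(2,3) by (auto dest: topological_tendstoD)
    then have ev: "\<forall>\<^sub>F h in nhds 0.
        ((\<lambda>t. Re (G (z + of_real t * d))) has_real_derivative
          Re (d * deriv G (z + of_real h * d))) (at h)"
      by (rule eventually_mono) (intro has_real_derivative_Re_along_line 1)
    have "((\<lambda>w. d * deriv G w) has_field_derivative d * deriv (deriv G) z) (at z)"
      using 2 by (rule DERIV_cmult)
    then have "((\<lambda>t. Re (d * deriv G (z + of_real t * d))) has_real_derivative
        Re (d * (d * deriv (deriv G) z))) (at 0)"
      by (intro has_real_derivative_Re_along_line[of "\<lambda>w. d * deriv G w"]) simp
    with ev show ?thesis unfolding has_deriv2_at_0_def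
      by (intro exI[of _ "\<lambda>h. Re (d * deriv G (z + of_real h * d))"] conjI)
  qed
  show ?thesis unfolding has_laplacian_at_def
    by (intro exI conjI, rule *, rule *) simp
qed

lemma has_laplacian_at_le_0_if_max:
  assumes "has_laplacian_at f z L" "open S" "z \<in> S" "\<And>w. w \<in> S \<Longrightarrow> f w \<le> f z"
  shows "L \<le> 0"
proof -
  have *: "\<forall>\<^sub>F h in nhds 0. f (z + of_real h * d) \<le> f (z + of_real 0 * d)" for d
  proof -
    have "((\<lambda>h. z + of_real h * d) \<longlongrightarrow> z + of_real 0 * d) (nhds 0)"
      by (intro tendsto_intros filterlim_ident)
    then have "\<forall>\<^sub>F h in nhds 0. z + of_real h * d \<in> S"
      using assms(2,3) by (auto dest: topological_tendstoD)
    then show ?thesis by (rule eventually_mono) (simp add: assms(4))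
  qed
  obtain p q where pq: "has_deriv2_at_0 (\<lambda>h. f (z + of_real h * 1)) p"
     "has_deriv2_at_0 (\<lambda>h. f (z + of_real h * \<i>)) q" "L = p + q"
    using assms unfolding has_laplacian_at_def by blast
  have "p \<le> 0" "q \<le> 0"
    by (rule has_deriv2_at_0_le_0_if_max[OF pq(1) *] has_deriv2_at_0_le_0_if_max[OF pq(2) *])+
  with pq show ?thesis by simp
qed

section \<open>Maximum principles for the mixed problem\<close>

lemma left_deriv_nonneg_if_max:
  fixes f :: "real \<Rightarrow> real"
  assumes "(f has_real_derivative D) (at 0 within {..0})" "\<And>h. -1 \<le> h \<Longrightarrow> h \<le> 0 \<Longrightarrow> f h \<le> f 0"
  shows "D \<ge> 0"
proof (rule ccontr)
  assume "\<not> D \<ge> 0"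
  then obtain d where d: "d > 0" "\<And>h. 0 < h \<Longrightarrow> 0 - h \<in> {..0} \<Longrightarrow> h < d \<Longrightarrow> f 0 < f (0 - h)"
    using has_real_derivative_neg_dec_left[OF assms(1)] by auto
  define h where "h = min 1 (d/2)"
  have "0 < h" "h \<le> 1" "h < d" using d(1) by (auto simp: h_def)
  then show False using d(2)[of h] assms(2)[of "- h"] by auto
qed

text \<open>On the compact disk the maximum is attained. In the interior it would contradict the
  positive Laplacian, on the circle off \<open>B\<close> the negative normal derivative; so it is
  attained in \<open>B\<close>.\<close>

lemma mixed_max_principle:
  fixes E :: "complex \<Rightarrow> real"
  assumes "continuous_on (cball 0 1) E"
    and "\<And>z. cmod z < 1 \<Longrightarrow> \<exists>L>0. has_laplacian_at E z L"
    and "\<And>z. cmod z = 1 \<Longrightarrow> z \<notin> B \<Longrightarrow>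
      \<exists>D<0. ((\<lambda>h. E (z + of_real h * z)) has_real_derivative D) (at 0 within {..0})"
    and "\<And>z. cmod z = 1 \<Longrightarrow> z \<in> B \<Longrightarrow> E z \<le> M"
    and "cmod z \<le> 1"
  shows "E z \<le> M"
proof -
  obtain w where w: "w \<in> cball 0 1" "\<And>z. z \<in> cball 0 1 \<Longrightarrow> E z \<le> E w"
    using continuous_attains_sup[OF compact_cball _ assms(1)] by auto
  have "\<not> cmod w < 1"
  proof
    assume "cmod w < 1"
    then obtain L where "L > 0" "has_laplacian_at E w L" using assms(2) by blast
    with has_laplacian_at_le_0_if_max[of E w L "ball 0 1"] w \<open>cmod w < 1\<close> show False by force
  qed
  with w(1) have w1: "cmod w = 1" by simp
  have "w \<in> B"
  proof (rule ccontr)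
    assume "w \<notin> B"
    with assms(3) w1 obtain D where D: "D < 0"
      "((\<lambda>h. E (w + of_real h * w)) has_real_derivative D) (at 0 within {..0})" by blast
    have "D \<ge> 0"
    proof (rule left_deriv_nonneg_if_max[OF D(2)])
      \<comment> \<open>For these \<open>h\<close> the point moves along the radius from the origin
        to \<open>w\<close>, hence stays in the disk.\<close>
      fix h :: real assume h: "-1 \<le> h" "h \<le> 0"
      have "w + of_real h * w = of_real (1 + h) * w" by (simp add: algebra_simps)
      then have "cmod (w + of_real h * w) \<le> 1" using w1 h by (simp add: norm_mult del: of_real_add)
      then show "E (w + of_real h * w) \<le> E (w + of_real 0 * w)" using w(2) by simp
    qed
    with D show False by simp
  qed
  with assms(4) w1 w(2)[of z] assms(5) show ?thesis by force
qed

text \<open>Adding a small multiple of \<open>\<phi>\<close>, which is strictly subharmonic and has strictly negative normal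
  derivative off \<open>B\<close>, replaces the Hopf boundary lemma and the strong maximum principle.\<close>

lemma mixed_max_principle_neumann:
  fixes V \<phi> :: "complex \<Rightarrow> real"
  assumes "continuous_on (cball 0 1) V" "continuous_on (cball 0 1) \<phi>"
    and "\<And>z. cmod z < 1 \<Longrightarrow> has_laplacian_at V z 0"
    and "\<And>z. cmod z < 1 \<Longrightarrow> \<exists>L>0. has_laplacian_at \<phi> z L"
    and "\<And>z. cmod z = 1 \<Longrightarrow> z \<notin> B \<Longrightarrow>
      ((\<lambda>h. V (z + of_real h * z)) has_real_derivative 0) (at 0 within {..0})"
    and "\<And>z. cmod z = 1 \<Longrightarrow> z \<notin> B \<Longrightarrow>
      \<exists>D<0. ((\<lambda>h. \<phi> (z + of_real h * z)) has_real_derivative D) (at 0 within {..0})"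
    and "\<And>z. cmod z = 1 \<Longrightarrow> z \<in> B \<Longrightarrow> V z \<le> M"
    and z: "cmod z \<le> 1"
  shows "V z \<le> M"
proof -
  have "compact (\<phi> ` cball 0 1)"
    using assms(2) by (rule compact_continuous_image) simp
  then have "bounded (\<phi> ` cball 0 1)" by (rule compact_imp_bounded)
  then obtain R where "R > 0" "\<forall>x\<in>\<phi> ` cball 0 1. norm x \<le> R" unfolding bounded_pos by blast
  then have R: "R > 0" "\<And>w. cmod w \<le> 1 \<Longrightarrow> \<bar>\<phi> w\<bar> \<le> R" by auto
  \<comment> \<open>The perturbation costs at most \<open>\<eta> * R\<close> on \<open>B\<close> and
    once more at \<open>z\<close>, whence the factor 2.\<close>
  have *: "V z \<le> M + \<eta> * (2 * R)" if "\<eta> > 0" for \<eta>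
  proof -
    have "V z + \<eta> * \<phi> z \<le> M + \<eta> * R"
    proof (rule mixed_max_principle[where B = B])
      show "continuous_on (cball 0 1) (\<lambda>z. V z + \<eta> * \<phi> z)"
        by (intro continuous_intros assms)
      show "\<exists>L>0. has_laplacian_at (\<lambda>z. V z + \<eta> * \<phi> z) w L" if w: "cmod w < 1" for w
      proof -
        obtain L where "L > 0" "has_laplacian_at \<phi> w L" using assms(4)[OF w] by blast
        from this(1) has_laplacian_at_add[OF assms(3)[OF w] has_laplacian_at_cmult[OF this(2), of \<eta>]]
        show ?thesis using \<open>\<eta> > 0\<close> by (intro exI[of _ "0 + \<eta> * L"] conjI) simp_all
      qed
      show "\<exists>D<0. ((\<lambda>h. V (w + of_real h * w) + \<eta> * \<phi> (w + of_real h * w))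
          has_real_derivative D) (at 0 within {..0})" if w: "cmod w = 1" "w \<notin> B" for w
      proof -
        obtain D where D: "D < 0"
          "((\<lambda>h. \<phi> (w + of_real h * w)) has_real_derivative D) (at 0 within {..0})"
          using assms(6)[OF w] by blast
        show ?thesis
          using DERIV_add[OF assms(5)[OF w] DERIV_cmult[OF D(2), of \<eta>]] D(1) \<open>\<eta> > 0\<close>
          by (intro exI[of _ "0 + \<eta> * D"]) (auto simp: mult_pos_neg)
      qed
      show "V w + \<eta> * \<phi> w \<le> M + \<eta> * R" if w: "cmod w = 1" "w \<in> B" for w
        using R(2)[of w] assms(7)[OF w] w \<open>\<eta> > 0\<close> by (intro add_mono mult_left_mono) auto
    qed (rule z)
    moreover have "\<eta> * \<phi> z \<ge> \<eta> * (- R)"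
      using R(2)[OF z] \<open>\<eta> > 0\<close> by (intro mult_left_mono) auto
    ultimately show ?thesis by (simp add: algebra_simps)
  qed
  show ?thesis
  proof (rule field_le_epsilon)
    fix e :: real assume "e > 0"
    then show "V z \<le> M + e" using *[of "e / (2 * R)"] R(1) by simp
  qed
qed

subsection \<open>The potential of one arc\<close>

text \<open>The product of the principal roots, not the principal root of the product: only the former
  is continuous on the closed disk.\<close>

definition arc_root :: "real \<Rightarrow> complex \<Rightarrow> complex" where
  "arc_root \<epsilon> z = csqrt (1 - z * cis \<epsilon>) * csqrt (1 - z * cis (- \<epsilon>))"

definition arc_map :: "real \<Rightarrow> complex \<Rightarrow> complex" where
  "arc_map \<epsilon> z = 1 - z + arc_root \<epsilon> z"

text \<open>Taken as the real part of a logarithm, so that harmonicity comes from holomorphy. On the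
  closed disk, for \<open>0 < \<epsilon> < 1\<close>, \<open>arc_map\<close> has positive real part
  and the branch cut is never met.\<close>

definition arc_potential :: "real \<Rightarrow> complex \<Rightarrow> real" where
  "arc_potential \<epsilon> z = Re (Ln (arc_map \<epsilon> z))"

lemma arc_root_square: "(arc_root \<epsilon> z)\<^sup>2 = 1 - 2 * of_real (cos \<epsilon>) * z + z\<^sup>2"
proof -
  have "(arc_root \<epsilon> z)\<^sup>2 = (1 - z * cis \<epsilon>) * (1 - z * cis (- \<epsilon>))"
    by (simp add: arc_root_def power_mult_distrib)
  also have "\<dots> = 1 - z * (cis \<epsilon> + cis (- \<epsilon>)) + z\<^sup>2 * (cis \<epsilon> * cis (- \<epsilon>))"
    by (simp add: algebra_simps power2_eq_square)
  also have "cis \<epsilon> + cis (- \<epsilon>) = 2 * of_real (cos \<epsilon>)" by (simp add: complex_eq_iff)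
  also have "cis \<epsilon> * cis (- \<epsilon>) = 1" by (simp add: cis_mult)
  finally show ?thesis by simp
qed

section \<open>The map stays in the right half-plane; continuity and holomorphy\<close>

lemma abs_Im_csqrt_le_Re:
  assumes "Re w \<ge> 0" shows "\<bar>Im (csqrt w)\<bar> \<le> Re (csqrt w)"
proof -
  have "Re w = (Re (csqrt w))\<^sup>2 - (Im (csqrt w))\<^sup>2" by (metis Re_power2 power2_csqrt)
  then have "(Im (csqrt w))\<^sup>2 \<le> (Re (csqrt w))\<^sup>2" using assms by linarith
  then show ?thesis using Re_csqrt[of w] by (metis abs_le_square_iff abs_of_nonneg)
qed

text \<open>Roots of numbers in the right half-plane lie in the sector where the imaginary part is
  dominated by the real part; multiplying two of them at most doubles the opening to a
  half-plane.\<close>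

lemma Re_csqrt_mult_nonneg:
  assumes "Re v \<ge> 0" "Re w \<ge> 0" shows "Re (csqrt v * csqrt w) \<ge> 0"
proof -
  have "\<bar>Im (csqrt v) * Im (csqrt w)\<bar> \<le> Re (csqrt v) * Re (csqrt w)"
    unfolding abs_mult using abs_Im_csqrt_le_Re[OF assms(1)] abs_Im_csqrt_le_Re[OF assms(2)]
    by (intro mult_mono Re_csqrt abs_ge_zero)
  then show ?thesis unfolding times_complex.sel by linarith
qed

lemma Re_one_minus_nonneg: "cmod w \<le> 1 \<Longrightarrow> Re (1 - w) \<ge> 0"
  using complex_Re_le_cmod[of w] by simp

lemma cmod_one_minus_square: "(cmod (1 - w))\<^sup>2 = 1 - 2 * Re w + (cmod w)\<^sup>2"
  unfolding cmod_power2 by (simp add: power2_eq_square algebra_simps)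

text \<open>The two sides differ by exactly \<open>(1 - (cmod w)\<^sup>2) / 2\<close>.\<close>

lemma Re_one_minus_ge:
  assumes "cmod w \<le> 1" shows "Re (1 - w) \<ge> (cmod (1 - w))\<^sup>2 / 2"
proof -
  have "(cmod w)\<^sup>2 \<le> 1" using assms by (simp add: power_le_one)
  then show ?thesis using cmod_one_minus_square[of w] by simp
qed

lemma Re_arc_root_nonneg: "cmod z \<le> 1 \<Longrightarrow> Re (arc_root \<epsilon> z) \<ge> 0"
  unfolding arc_root_def
  by (intro Re_csqrt_mult_nonneg Re_one_minus_nonneg) (simp_all add: norm_mult)

lemma cos_less_one:
  assumes "0 < x" "x < 1" shows "cos x < (1::real)"
  using cos_monotone_0_pi[of 0 x] assms pi_gt3 by simp

lemma Re_arc_map_ge: "cmod z \<le> 1 \<Longrightarrow> Re (arc_map \<epsilon> z) \<ge> (cmod (1 - z))\<^sup>2 / 2"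
  using Re_arc_root_nonneg[of z \<epsilon>] Re_one_minus_ge[of z] unfolding arc_map_def by simp

text \<open>The lower bound of \<open>Re_arc_map_ge\<close> degenerates only at
  \<open>z = 1\<close>. There the square of the root is \<open>2 - 2 * cos \<epsilon> > 0\<close>,
  impossible for a purely imaginary root.\<close>

lemma Re_arc_map_pos:
  assumes "cmod z \<le> 1" "0 < \<epsilon>" "\<epsilon> < 1" shows "Re (arc_map \<epsilon> z) > 0"
proof (cases "z = 1")
  case True
  have sq: "(arc_root \<epsilon> z)\<^sup>2 = of_real (2 - 2 * cos \<epsilon>)" unfolding arc_root_square True by simp
  have "Re (arc_root \<epsilon> z) \<noteq> 0"
  proof
    assume "Re (arc_root \<epsilon> z) = 0"
    then have "Re ((arc_root \<epsilon> z)\<^sup>2) \<le> 0" by (simp add: power2_eq_square)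
    then show False using cos_less_one[OF assms(2,3)] unfolding sq by simp
  qed
  then show ?thesis using Re_arc_root_nonneg[OF assms(1), of \<epsilon>] True by (simp add: arc_map_def)
next
  case False
  then have "(cmod (1 - z))\<^sup>2 / 2 > 0" by simp
  with Re_arc_map_ge[OF assms(1), of \<epsilon>] show ?thesis by linarith
qed

lemma arc_map_neq_0: "cmod z \<le> 1 \<Longrightarrow> 0 < \<epsilon> \<Longrightarrow> \<epsilon> < 1 \<Longrightarrow> arc_map \<epsilon> z \<noteq> 0"
  using Re_arc_map_pos[of z \<epsilon>] by auto

lemma arc_potential_eq:
  "cmod z \<le> 1 \<Longrightarrow> 0 < \<epsilon> \<Longrightarrow> \<epsilon> < 1 \<Longrightarrow> arc_potential \<epsilon> z = ln (cmod (arc_map \<epsilon> z))"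
  unfolding arc_potential_def by (rule Re_Ln[OF arc_map_neq_0])

lemma arc_map_notin_nonpos_Reals:
  "cmod z \<le> 1 \<Longrightarrow> 0 < \<epsilon> \<Longrightarrow> \<epsilon> < 1 \<Longrightarrow> arc_map \<epsilon> z \<notin> \<real>\<^sub>\<le>\<^sub>0"
  using Re_arc_map_pos[of z \<epsilon>] by (auto simp: complex_nonpos_Reals_iff)

lemma one_minus_notin_nonpos_Reals:
  assumes "cmod w \<le> 1" "w \<noteq> 1" shows "1 - w \<notin> \<real>\<^sub>\<le>\<^sub>0"
proof -
  have "(cmod (1 - w))\<^sup>2 / 2 > 0" using assms by simp
  with Re_one_minus_ge[OF assms(1)] have "Re (1 - w) > 0" by linarith
  then show ?thesis by (auto simp: complex_nonpos_Reals_iff)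
qed

text \<open>Only the branch point \<open>w = 1\<close> meets the cut. Continuity there follows from
  the modulus of the root, \<open>sqrt (cmod (1 - w))\<close>, tending to 0.\<close>

lemma continuous_on_csqrt_one_minus: "continuous_on (cball 0 1) (\<lambda>w. csqrt (1 - w))"
  unfolding continuous_on_eq_continuous_within
proof
  fix w :: complex assume w: "w \<in> cball 0 1"
  show "continuous (at w within cball 0 1) (\<lambda>w. csqrt (1 - w))"
  proof (cases "w = 1")
    case True
    have "((\<lambda>w. sqrt (cmod (1 - w))) \<longlongrightarrow> sqrt (cmod (1 - w))) (at w within cball 0 1)"
      by (intro tendsto_intros)
    then have "((\<lambda>w. cmod (csqrt (1 - w))) \<longlongrightarrow> 0) (at w within cball 0 1)" using True by simp
    then have "((\<lambda>w. csqrt (1 - w)) \<longlongrightarrow> 0) (at w within cball 0 1)"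
      by (simp only: tendsto_norm_zero_iff)
    then show ?thesis using True by (simp add: continuous_within)
  next
    case False
    then have "isCont (\<lambda>w. csqrt (1 - w)) w"
      using one_minus_notin_nonpos_Reals[of w] w by (intro isCont_csqrt' continuous_intros) auto
    then show ?thesis by (rule continuous_at_imp_continuous_within)
  qed
qed

lemma continuous_on_arc_potential:
  assumes "0 < \<epsilon>" "\<epsilon> < 1" shows "continuous_on (cball 0 1) (arc_potential \<epsilon>)"
proof -
  have *: "continuous_on (cball 0 1) (\<lambda>z. csqrt (1 - z * cis t))" for t
    by (rule continuous_on_compose2[OF continuous_on_csqrt_one_minus])
       (auto intro!: continuous_intros simp: norm_mult)
  have "continuous_on (cball 0 1) (arc_map \<epsilon>)"
    unfolding arc_map_def arc_root_def by (intro continuous_intros *)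
  then show ?thesis
    unfolding arc_potential_def using arc_map_notin_nonpos_Reals assms
    by (intro continuous_intros continuous_on_Ln) auto
qed

lemma holomorphic_Ln_arc_map:
  assumes "0 < \<epsilon>" "\<epsilon> < 1" shows "(\<lambda>z. Ln (arc_map \<epsilon> z)) holomorphic_on ball 0 1"
proof -
  have *: "1 - z * cis t \<notin> \<real>\<^sub>\<le>\<^sub>0" if "z \<in> ball 0 1" for z t
    using that by (intro one_minus_notin_nonpos_Reals) (auto simp: norm_mult dest: arg_cong[of _ _ cmod])
  have "arc_map \<epsilon> holomorphic_on ball 0 1"
    unfolding arc_map_def arc_root_def by (intro holomorphic_intros *)
  then show ?thesis
    using arc_map_notin_nonpos_Reals assms by (intro holomorphic_intros) auto
qed

section \<open>Values on the arc and normal derivative off it\<close>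

lemma Re_eq_0_if_square_nonpos:
  assumes "w\<^sup>2 = of_real r" "r \<le> 0" shows "Re w = 0"
proof -
  have "Re w * Im w = 0" "(Re w)\<^sup>2 - (Im w)\<^sup>2 = r"
    using arg_cong[OF assms(1), of Im] arg_cong[OF assms(1), of Re]
    by (simp_all add: Im_power2 Re_power2)
  then have "Re w \<noteq> 0 \<Longrightarrow> (Re w)\<^sup>2 \<le> 0" using assms(2) by simp
  then show ?thesis by auto
qed

text \<open>Factor out \<open>z\<close> and use that its inverse is its conjugate. The cases needed
  are \<open>k = cos \<epsilon>\<close> for the root, \<open>k = 1\<close> for
  \<open>(1 - z)\<^sup>2\<close> and \<open>k = -1\<close> for
  \<open>(1 + z)\<^sup>2\<close>.\<close>

lemma unit_circle_square:
  assumes "cmod z = 1"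
  shows "1 - 2 * of_real k * z + z\<^sup>2 = of_real (2 * (Re z - k)) * z"
proof -
  have "1 = z * cnj z" using assms by (simp add: complex_norm_square[symmetric])
  then have "1 - 2 * of_real k * z + z\<^sup>2 = z * (z + cnj z - 2 * of_real k)"
    by (simp add: algebra_simps power2_eq_square)
  then show ?thesis by (simp add: complex_add_cnj algebra_simps)
qed

text \<open>On the arc the squares of \<open>arc_root \<epsilon> z\<close> and \<open>1 - z\<close>
  are a nonnegative and a nonpositive multiple of the same \<open>z\<close>, so these two summands
  of \<open>arc_map\<close> are perpendicular. By Pythagoras the squared modulus is
  \<open>q + r\<close>, in which \<open>Re z\<close> cancels.\<close>

lemma arc_potential_on_arc:
  assumes z: "cmod z = 1" "Re z \<ge> cos \<epsilon>" and "0 < \<epsilon>" "\<epsilon> < 1"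
  shows "arc_potential \<epsilon> z = ln (2 - 2 * cos \<epsilon>) / 2"
proof -
  define r where "r = 2 * (Re z - cos \<epsilon>)"
  define q where "q = 2 * (1 - Re z)"
  have "Re z \<le> 1" using complex_Re_le_cmod[of z] z by simp
  then have "r \<ge> 0" "q \<ge> 0" using z by (auto simp: r_def q_def)
  have s: "(arc_root \<epsilon> z)\<^sup>2 = of_real r * z"
    unfolding arc_root_square r_def using z(1) by (rule unit_circle_square)
  have m: "(1 - z)\<^sup>2 = - of_real q * z"
    using unit_circle_square[OF z(1), of 1]
    by (simp add: q_def power2_eq_square algebra_simps)
  have zz: "z * cnj z = 1" using z(1) by (simp add: complex_norm_square[symmetric])
  have "((1 - z) * cnj (arc_root \<epsilon> z))\<^sup>2 = of_real (- (q * r))"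
  proof -
    have "((1 - z) * cnj (arc_root \<epsilon> z))\<^sup>2 = (1 - z)\<^sup>2 * cnj ((arc_root \<epsilon> z)\<^sup>2)"
      by (simp add: power_mult_distrib)
    also have "\<dots> = - of_real (q * r) * (z * cnj z)" unfolding s m by simp
    finally show ?thesis unfolding zz by simp
  qed
  then have re: "Re ((1 - z) * cnj (arc_root \<epsilon> z)) = 0"
    by (rule Re_eq_0_if_square_nonpos) (use \<open>r \<ge> 0\<close> \<open>q \<ge> 0\<close> in simp)
  have "(cmod (arc_map \<epsilon> z))\<^sup>2 = (cmod (1 - z))\<^sup>2 + (cmod (arc_root \<epsilon> z))\<^sup>2
      + 2 * Re ((1 - z) * cnj (arc_root \<epsilon> z))"
    unfolding arc_map_def cmod_power2 by (simp add: power2_eq_square algebra_simps)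
  also have "(cmod (1 - z))\<^sup>2 = q"
    using arg_cong[OF m, of cmod] z(1) \<open>q \<ge> 0\<close> by (simp add: norm_mult norm_power)
  also have "(cmod (arc_root \<epsilon> z))\<^sup>2 = r"
    using arg_cong[OF s, of cmod] z(1) \<open>r \<ge> 0\<close> by (simp add: norm_mult norm_power)
  finally have "(cmod (arc_map \<epsilon> z))\<^sup>2 = 2 - 2 * cos \<epsilon>" unfolding re by (simp add: q_def r_def)
  moreover have "cmod (arc_map \<epsilon> z) > 0" using arc_map_neq_0 assms by simp
  ultimately show ?thesis
    using arc_potential_eq[of z \<epsilon>] assms ln_realpow[of "cmod (arc_map \<epsilon> z)" 2] by simp
qed

lemma arc_potential_normal_derivative:
  assumes z: "cmod z = 1" "Re z < cos \<epsilon>" and "0 < \<epsilon>" "\<epsilon> < 1"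
  shows "((\<lambda>h. arc_potential \<epsilon> (z + of_real h * z)) has_real_derivative 1 / 2) (at 0)"
proof -
  define s where "s = arc_root \<epsilon> z"
  define g where "g = arc_map \<epsilon> z"
  define k where "k = complex_of_real (cos \<epsilon>)"
  \<comment> \<open>A factor vanishes only at an end point of the arc, where the real part is
    \<open>cos \<epsilon>\<close>; this is excluded by the strict inequality.\<close>
  have nn: "1 - z * cis t \<notin> \<real>\<^sub>\<le>\<^sub>0" if "t = \<epsilon> \<or> t = - \<epsilon>" for t
  proof (rule one_minus_notin_nonpos_Reals)
    show "z * cis t \<noteq> 1"
    proof
      assume "z * cis t = 1"
      then have "z = cis (- t)"
        by (metis cis_inverse cis_neq_zero inverse_unique mult.commute)
      then show False using z(2) that by auto
    qed
  qed (simp add: norm_mult z)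
  have s2: "s\<^sup>2 = 1 - 2 * k * z + z\<^sup>2" unfolding s_def k_def by (rule arc_root_square)
  have s2': "s\<^sup>2 = of_real (2 * (Re z - cos \<epsilon>)) * z"
    unfolding s_def arc_root_square using z(1) by (rule unit_circle_square)
  have "z \<noteq> 0" using z(1) by auto
  then have "s \<noteq> 0" using z(2) s2' by auto
  have "g \<noteq> 0" unfolding g_def using arc_map_neq_0 assms by simp
  have "\<exists>s'. (arc_root \<epsilon> has_field_derivative s') (at z)"
    unfolding arc_root_def using nn[of \<epsilon>] nn[of "- \<epsilon>"]
    by (intro exI) (auto intro!: derivative_eq_intros)
  then obtain s' where s': "(arc_root \<epsilon> has_field_derivative s') (at z)" by blast
  \<comment> \<open>Differentiating the polynomial \<open>s\<^sup>2\<close> in two ways gives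
    \<open>s * s' = z - k\<close> without handling the derivatives of the separate roots.\<close>
  have "((\<lambda>z. (arc_root \<epsilon> z)\<^sup>2) has_field_derivative 2 * s * s') (at z)"
    by (rule derivative_eq_intros s' | simp add: s_def)+
  moreover have "((\<lambda>z. (arc_root \<epsilon> z)\<^sup>2) has_field_derivative 2 * z - 2 * k) (at z)"
    unfolding arc_root_square k_def by (auto intro!: derivative_eq_intros)
  ultimately have "2 * s * s' = 2 * z - 2 * k" by (rule DERIV_unique)
  then have "2 * (s * s') = 2 * (z - k)" by (simp add: algebra_simps)
  then have "s * s' = z - k" by (metis mult_cancel_left zero_neq_numeral)
  then have s'_eq: "s' = (z - k) / s" using \<open>s \<noteq> 0\<close> by (simp add: field_simps)
  have "(arc_map \<epsilon> has_field_derivative - 1 + s') (at z)"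
    unfolding arc_map_def by (auto intro!: derivative_eq_intros s')
  then have "((\<lambda>z. Ln (arc_map \<epsilon> z)) has_field_derivative (- 1 + s') / g) (at z)"
    using arc_map_notin_nonpos_Reals[of z \<epsilon>] assms unfolding g_def
    by (auto intro!: derivative_eq_intros simp: divide_inverse mult.commute)
  then have "((\<lambda>h. arc_potential \<epsilon> (z + of_real h * z)) has_real_derivative
      Re (z * ((- 1 + s') / g))) (at 0)"
    unfolding arc_potential_def by (intro has_real_derivative_Re_along_line) simp
  also have "z * ((- 1 + s') / g) = 1 / 2 - (1 + z) / (2 * s)"
  proof -
    have "g = 1 - z + s" by (simp add: g_def s_def arc_map_def)
    \<comment> \<open>What remains after clearing the denominators \<open>s\<close> and
      \<open>g\<close>; it is the formula for \<open>s\<^sup>2\<close> rearranged.\<close>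
    have "2 * z * (z - k - s) = (s - 1 - z) * (1 - z + s)"
      using s2 by (simp add: algebra_simps power2_eq_square)
    then show ?thesis unfolding s'_eq using \<open>s \<noteq> 0\<close> \<open>g \<noteq> 0\<close> unfolding \<open>g = 1 - z + s\<close>
      by (simp add: divide_simps) (simp add: algebra_simps)
  qed
  also have "Re ((1 + z) / s) = 0"
  proof (rule Re_eq_0_if_square_nonpos)
    have "(1 + z)\<^sup>2 = of_real (2 * (Re z + 1)) * z"
      using unit_circle_square[OF z(1), of "-1"] by (simp add: power2_eq_square algebra_simps)
    then show "((1 + z) / s)\<^sup>2 = of_real ((Re z + 1) / (Re z - cos \<epsilon>))"
      unfolding power_divide s2' using \<open>z \<noteq> 0\<close> by (simp add: divide_simps) (simp add: algebra_simps)
    have "Re z \<ge> - 1" using abs_Re_le_cmod[of z] z(1) by simp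
    then show "(Re z + 1) / (Re z - cos \<epsilon>) \<le> 0" using z(2) by (simp add: divide_nonneg_neg)
  qed
  then have "Re (1 / 2 - (1 + z) / (2 * s)) = 1 / 2"
    by (metis Re_divide_numeral diff_zero div_0 divide_divide_eq_left' minus_complex.sel(1) one_complex.sel(1) mult.commute)
  finally show ?thesis .
qed

section \<open>Quantitative estimates far from the arc and on it\<close>

lemma abs_ln_diff_le:
  assumes "m > 0" "m \<le> a" "m \<le> b" shows "\<bar>ln a - ln b\<bar> \<le> \<bar>a - b\<bar> / (m::real)"
proof -
  have *: "ln a - ln b \<le> \<bar>a - b\<bar> / m" if "m \<le> a" "m \<le> b" for a b :: real
  proof -
    have "ln a - ln b \<le> (a - b) / b" using ln_diff_le[of a b] that assms(1) by simp
    also have "\<dots> \<le> \<bar>a - b\<bar> / b" using that assms(1) by (intro divide_right_mono) auto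
    also have "\<dots> \<le> \<bar>a - b\<bar> / m" using that assms(1) by (intro divide_left_mono) auto
    finally show ?thesis .
  qed
  from *[of a b] *[of b a] assms show ?thesis by (simp add: abs_minus_commute abs_le_iff)
qed

lemma one_minus_cos_le: "1 - cos x \<le> x\<^sup>2 / (2::real)"
proof -
  have "\<bar>sin (x/2)\<bar> \<le> \<bar>x/2\<bar>" by (rule abs_sin_x_le_abs_x)
  then have "(sin (x/2))\<^sup>2 \<le> (x/2)\<^sup>2" by (metis abs_le_square_iff)
  then show ?thesis using cos_double_sin[of "x/2"] by (simp add: power2_eq_square)
qed

text \<open>Since \<open>s\<^sup>2 - (1 - z)\<^sup>2\<close> is
  \<open>2 * z * (1 - cos \<epsilon>)\<close> and one factor is \<open>g\<close>, a lower bound on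
  \<open>cmod g\<close> makes \<open>s\<close> close to \<open>1 - z\<close>, hence \<open>g\<close>
  close to \<open>2 * (1 - z)\<close>. The bound \<open>r\<^sup>2 / 2\<close> is used twice, for
  this division and for the Lipschitz constant of \<open>ln\<close>, which explains
  \<open>r ^ 4\<close>.\<close>

lemma arc_potential_far:
  assumes z: "cmod z \<le> 1" "r \<le> cmod (1 - z)" and "0 < r" "0 < \<epsilon>" "\<epsilon> < 1"
  shows "\<bar>arc_potential \<epsilon> z - ln (2 * cmod (1 - z))\<bar> \<le> 4 * \<epsilon>\<^sup>2 / r ^ 4"
proof -
  define s where "s = arc_root \<epsilon> z"
  define g where "g = arc_map \<epsilon> z"
  have g: "g = 1 - z + s" by (simp add: g_def s_def arc_map_def)
  have "cmod (1 - z) \<le> 2" using norm_triangle_ineq4[of 1 z] z(1) by simp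
  have "r\<^sup>2 / 2 \<le> (cmod (1 - z))\<^sup>2 / 2" using assms(2,3) by (simp add: power_mono)
  also have "\<dots> \<le> Re g" unfolding g_def by (rule Re_arc_map_ge[OF z(1)])
  also have "\<dots> \<le> cmod g" by (rule complex_Re_le_cmod)
  finally have ge: "r\<^sup>2 / 2 \<le> cmod g" .
  have "r\<^sup>2 / 2 \<le> 2 * cmod (1 - z)"
  proof -
    have "r * r \<le> r * 2" using assms \<open>cmod (1 - z) \<le> 2\<close> by (intro mult_left_mono) auto
    then have "r\<^sup>2 \<le> r * 2" by (simp add: power2_eq_square)
    then show ?thesis using assms(2,3) by linarith
  qed
  have pos: "r\<^sup>2 / 2 > 0" using assms by simp
  have "(s - (1 - z)) * g = 2 * z * of_real (1 - cos \<epsilon>)"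
    unfolding g using arc_root_square[of \<epsilon> z] unfolding s_def[symmetric]
    by (simp add: algebra_simps power2_eq_square)
  then have "cmod (s - (1 - z)) * cmod g = 2 * cmod z * (1 - cos \<epsilon>)"
    by (metis norm_mult norm_of_real abs_of_nonneg cos_le_one diff_ge_0_iff_ge norm_numeral)
  also have "\<dots> \<le> 2 * 1 * (\<epsilon>\<^sup>2 / 2)"
    using z(1) one_minus_cos_le[of \<epsilon>] by (intro mult_mono) auto
  finally have "cmod (s - (1 - z)) * cmod g \<le> \<epsilon>\<^sup>2" by simp
  then have "cmod (s - (1 - z)) \<le> \<epsilon>\<^sup>2 / cmod g"
    using less_le_trans[OF pos ge] by (simp add: pos_le_divide_eq)
  also have "\<dots> \<le> \<epsilon>\<^sup>2 / (r\<^sup>2 / 2)" by (rule frac_le[OF zero_le_power2 order_refl pos ge])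
  finally have b: "cmod (s - (1 - z)) \<le> 2 * \<epsilon>\<^sup>2 / r\<^sup>2" by (simp add: mult.commute)
  have "\<bar>cmod g - 2 * cmod (1 - z)\<bar> = \<bar>cmod g - cmod (2 * (1 - z))\<bar>"
    unfolding norm_mult by simp
  also have "\<dots> \<le> cmod (g - 2 * (1 - z))" by (rule norm_triangle_ineq3)
  also have "\<dots> = cmod (s - (1 - z))" unfolding g by (simp add: algebra_simps)
  also note b
  finally have d: "\<bar>cmod g - 2 * cmod (1 - z)\<bar> \<le> 2 * \<epsilon>\<^sup>2 / r\<^sup>2" .
  have "\<bar>ln (cmod g) - ln (2 * cmod (1 - z))\<bar> \<le> \<bar>cmod g - 2 * cmod (1 - z)\<bar> / (r\<^sup>2 / 2)"
    by (rule abs_ln_diff_le) fact+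
  also have "\<dots> \<le> (2 * \<epsilon>\<^sup>2 / r\<^sup>2) / (r\<^sup>2 / 2)" by (intro divide_right_mono d) auto
  also have "\<dots> = 4 * \<epsilon>\<^sup>2 / r ^ 4" by (simp add: power4_eq_xxxx power2_eq_square)
  finally show ?thesis using arc_potential_eq[of z \<epsilon>] assms by (simp add: g_def)
qed

text \<open>With \<open>y = \<epsilon> / 2\<close> the half-angle formula turns the difference into
  \<open>ln (sin y / y)\<close>, which is quadratically small. A linear bound suffices for the error
  on the arcs.\<close>

lemma ln_two_minus_two_cos:
  assumes "0 < \<epsilon>" "\<epsilon> < (1::real)" shows "\<bar>ln (2 - 2 * cos \<epsilon>) / 2 - ln \<epsilon>\<bar> \<le> \<epsilon>"
proof -
  define y where "y = \<epsilon> / 2"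
  have y: "0 < y" "y < 1" "\<epsilon> = 2 * y" using assms by (auto simp: y_def)
  have "y < pi / 2" using y pi_gt3 by simp
  then have "sin y > 0" "cos y > 0" using y pi_gt3 by (auto intro!: sin_gt_zero cos_gt_zero)
  have "2 - 2 * cos \<epsilon> = (2 * sin y)\<^sup>2"
    unfolding y(3) cos_double_sin by (simp add: power2_eq_square)
  then have "ln (2 - 2 * cos \<epsilon>) / 2 = ln (2 * sin y)"
    using \<open>sin y > 0\<close> ln_realpow[of "2 * sin y" 2] by simp
  also have "\<dots> - ln \<epsilon> = ln (sin y / y)"
    using \<open>sin y > 0\<close> y by (simp add: ln_mult ln_div)
  finally have eq: "ln (2 - 2 * cos \<epsilon>) / 2 - ln \<epsilon> = ln (sin y / y)" .
  have le: "sin y / y \<le> 1" using sin_x_le_x[of y] y by simp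
  have "cos y * y \<le> sin y"
  proof -
    obtain t where t: "0 < t" "t < y" "sin y - sin 0 = (y - 0) * cos t"
      using MVT2[of 0 y sin cos] y by auto
    have "cos y \<le> cos t" using t y pi_gt3 by (intro cos_monotone_0_pi_le) auto
    then show ?thesis using t(3) y mult_right_mono[of "cos y" "cos t" y] by (simp add: mult.commute)
  qed
  then have "cos y \<le> sin y / y" using y by (simp add: field_simps)
  then have ge: "1 - y\<^sup>2 / 2 \<le> sin y / y" using one_minus_cos_le[of y] by linarith
  have "y\<^sup>2 / 2 \<le> 1 / 2" using y by (simp add: power_le_one)
  have half: "1 / 2 \<le> sin y / y" using ge \<open>y\<^sup>2 / 2 \<le> 1 / 2\<close> by linarith
  have "\<bar>ln (sin y / y) - ln 1\<bar> \<le> \<bar>sin y / y - 1\<bar> / (1/2)"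
    by (rule abs_ln_diff_le[OF _ half]) auto
  also have "\<dots> \<le> y\<^sup>2" using ge le by simp
  also have "\<dots> \<le> \<epsilon>" using y mult_left_mono[of y 1 y] by (simp add: power2_eq_square)
  finally show ?thesis unfolding eq by simp
qed

section \<open>Rotation to an arc with arbitrary centre on the circle\<close>

definition arc_potential_at :: "complex \<Rightarrow> real \<Rightarrow> complex \<Rightarrow> real" where
  "arc_potential_at p \<epsilon> z = arc_potential \<epsilon> (z * cnj p)"

text \<open>A half-plane; for \<open>p\<close> on the unit circle and small
  \<open>\<epsilon>\<close> it cuts out of the circle the arc with its end points. This avoids
  choosing angles.\<close>

definition closed_arc :: "complex \<Rightarrow> real \<Rightarrow> complex set" where
  "closed_arc p \<epsilon> = {z. cos \<epsilon> \<le> Re (z * cnj p)}"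

lemma cmod_one_minus_mult_cnj:
  assumes "cmod p = 1" shows "cmod (1 - z * cnj p) = cmod (z - p)"
proof -
  have "p * cnj p = 1" using assms by (simp add: complex_norm_square[symmetric])
  then have "1 - z * cnj p = (p - z) * cnj p" by (simp add: left_diff_distrib)
  then show ?thesis using assms by (simp add: norm_mult norm_minus_commute)
qed

context
  fixes p :: complex and \<epsilon> :: real
  assumes p: "cmod p = 1" and \<epsilon>: "0 < \<epsilon>" "\<epsilon> < 1"
begin

lemma continuous_on_arc_potential_at: "continuous_on (cball 0 1) (arc_potential_at p \<epsilon>)"
  unfolding arc_potential_at_def
proof (rule continuous_on_compose2[OF continuous_on_arc_potential[OF \<epsilon>]])
  show "continuous_on (cball 0 1) (\<lambda>z. z * cnj p)" by (intro continuous_intros)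
  show "(\<lambda>z. z * cnj p) ` cball 0 1 \<subseteq> cball 0 1" by (auto simp: norm_mult p)
qed

lemma has_laplacian_arc_potential_at:
  assumes "cmod z < 1" shows "has_laplacian_at (arc_potential_at p \<epsilon>) z 0"
proof -
  have "(\<lambda>z. Ln (arc_map \<epsilon> (z * cnj p))) holomorphic_on ball 0 1"
  proof -
    have "(\<lambda>z. z * cnj p) holomorphic_on ball 0 1" by (intro holomorphic_intros)
    moreover have "(\<lambda>z. z * cnj p) ` ball 0 1 \<subseteq> ball 0 1" by (auto simp: norm_mult p)
    ultimately have "(\<lambda>z. Ln (arc_map \<epsilon> z)) \<circ> (\<lambda>z. z * cnj p) holomorphic_on ball 0 1"
      by (rule holomorphic_on_compose_gen[OF _ holomorphic_Ln_arc_map[OF \<epsilon>]])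
    then show ?thesis by (simp add: o_def)
  qed
  from has_laplacian_at_Re_holomorphic[OF this] assms show ?thesis
    unfolding arc_potential_at_def arc_potential_def by simp
qed

lemma has_normal_derivative_arc_potential_at:
  assumes "cmod z = 1" "z \<notin> closed_arc p \<epsilon>"
  shows "((\<lambda>h. arc_potential_at p \<epsilon> (z + of_real h * z)) has_real_derivative 1 / 2) (at 0)"
proof -
  have "(z + of_real h * z) * cnj p = z * cnj p + of_real h * (z * cnj p)" for h
    by (simp add: distrib_right mult.assoc)
  moreover have "cmod (z * cnj p) = 1" using assms(1) p by (simp add: norm_mult)
  moreover have "Re (z * cnj p) < cos \<epsilon>" using assms(2) unfolding closed_arc_def by auto
  ultimately show ?thesis
    using arc_potential_normal_derivative[OF _ _ \<epsilon>, of "z * cnj p"]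
    unfolding arc_potential_at_def by presburger
qed

lemma arc_potential_at_closed_arc:
  assumes "cmod z = 1" "z \<in> closed_arc p \<epsilon>"
  shows "\<bar>arc_potential_at p \<epsilon> z - ln \<epsilon>\<bar> \<le> \<epsilon>"
proof -
  have "arc_potential_at p \<epsilon> z = ln (2 - 2 * cos \<epsilon>) / 2"
    unfolding arc_potential_at_def
  proof (rule arc_potential_on_arc)
    show "cmod (z * cnj p) = 1" using assms(1) p by (simp add: norm_mult)
    show "cos \<epsilon> \<le> Re (z * cnj p)" using assms(2) unfolding closed_arc_def by blast
  qed (rule \<epsilon>)+
  then show ?thesis using ln_two_minus_two_cos[OF \<epsilon>] by simp
qed

lemma arc_potential_at_far:
  assumes "cmod z \<le> 1" "0 < r" "r \<le> cmod (z - p)"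
  shows "\<bar>arc_potential_at p \<epsilon> z - (ln 2 + ln (cmod (z - p)))\<bar> \<le> 4 / r ^ 4 * \<epsilon>"
proof -
  have "cmod (z - p) > 0" using assms by linarith
  then have "ln (2 * cmod (z - p)) = ln 2 + ln (cmod (z - p))" by (intro ln_mult_pos) auto
  then have "\<bar>arc_potential_at p \<epsilon> z - (ln 2 + ln (cmod (z - p)))\<bar> \<le> 4 * \<epsilon>\<^sup>2 / r ^ 4"
    using arc_potential_far[of "z * cnj p" r \<epsilon>] cmod_one_minus_mult_cnj[OF p, of z] assms p \<epsilon>
    unfolding arc_potential_at_def by (simp add: norm_mult)
  also have "\<dots> = 4 / r ^ 4 * (\<epsilon> * \<epsilon>)" by (simp add: power2_eq_square)
  also have "\<dots> \<le> 4 / r ^ 4 * (\<epsilon> * 1)" using \<epsilon> assms by (intro mult_left_mono) auto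
  finally show ?thesis by simp
qed

text \<open>The squared chord is \<open>2 * (1 - Re (z * cnj p))\<close>, at most
  \<open>2 * (1 - cos \<epsilon>)\<close>. It keeps the first arc away from the centre of the
  second.\<close>

lemma closed_arc_dist:
  assumes "cmod z = 1" "z \<in> closed_arc p \<epsilon>" shows "cmod (z - p) \<le> \<epsilon>"
proof -
  have "(cmod (z - p))\<^sup>2 = (cmod (1 - z * cnj p))\<^sup>2" by (simp add: cmod_one_minus_mult_cnj[OF p])
  also have "\<dots> = 1 - 2 * Re (z * cnj p) + (cmod (z * cnj p))\<^sup>2"
    by (rule cmod_one_minus_square)
  also have "\<dots> = 2 * (1 - Re (z * cnj p))" using assms p by (simp add: norm_mult)
  also have "\<dots> \<le> 2 * (1 - cos \<epsilon>)" using assms by (simp add: closed_arc_def)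
  also have "\<dots> \<le> \<epsilon>\<^sup>2" using one_minus_cos_le[of \<epsilon>] by simp
  finally show ?thesis by (rule power2_le_imp_le) (use \<epsilon> in simp)
qed

end

subsection \<open>Two arcs\<close>

lemma has_normal_derivative_cmod_square:
  assumes "cmod z = 1"
  shows "((\<lambda>h. (cmod (z + of_real h * z))\<^sup>2) has_real_derivative 2) (at 0)"
proof -
  have "(cmod (z + of_real h * z))\<^sup>2 = (1 + h)\<^sup>2" for h
  proof -
    have "z + of_real h * z = of_real (1 + h) * z" by (simp add: algebra_simps)
    then show ?thesis using assms by (simp add: norm_mult power_mult_distrib del: of_real_add)
  qed
  then show ?thesis by (auto intro!: derivative_eq_intros)
qed

text \<open>On the arc around \<open>p\<close> the potential of \<open>p\<close> is
  \<open>ln \<epsilon>\<close> up to \<open>\<epsilon>\<close> (the 1 in the constant). The other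
  potential is seen from distance at least \<open>c\<^sub>0 / 2\<close>: the far estimate with this
  radius gives \<open>4 * 2 ^ 4 = 64\<close>, and replacing \<open>z\<close> by \<open>p\<close> in
  the logarithm costs its Lipschitz constant \<open>2 / c\<^sub>0\<close>.\<close>

lemma two_arc_potential_on_arc:
  fixes a b c\<^sub>0 :: real
  assumes p: "cmod p = 1" "0 < \<epsilon>" "\<epsilon> < 1" and q: "cmod q = 1" "0 < \<eta>" "\<eta> < 1"
    and z: "cmod z = 1" "z \<in> closed_arc p \<epsilon>"
    and c: "0 < c\<^sub>0" "c\<^sub>0 \<le> cmod (p - q)" "\<epsilon> \<le> c\<^sub>0 / 2"
    and ab: "0 \<le> a" "a \<le> 1" "0 \<le> b" "b \<le> 1"
  shows "\<bar>a * arc_potential_at p \<epsilon> z + b * arc_potential_at q \<eta> z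
      - (a * ln \<epsilon> + b * (ln 2 + ln (cmod (p - q))))\<bar> \<le> (1 + 64 / c\<^sub>0 ^ 4 + 2 / c\<^sub>0) * (\<epsilon> + \<eta>)"
proof -
  have zp: "cmod (z - p) \<le> \<epsilon>" by (rule closed_arc_dist[OF p z])
  have "cmod (p - q) \<le> cmod (p - z) + cmod (z - q)" by (rule norm_diff_triangle_le) auto
  then have zq: "c\<^sub>0 / 2 \<le> cmod (z - q)" using zp c by (simp add: norm_minus_commute)
  have "\<bar>cmod (z - q) - cmod (p - q)\<bar> \<le> \<epsilon>"
    using norm_triangle_ineq3[of "z - q" "p - q"] zp by simp
  then have "\<bar>cmod (z - q) - cmod (p - q)\<bar> / (c\<^sub>0 / 2) \<le> \<epsilon> / (c\<^sub>0 / 2)"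
    using c by (intro divide_right_mono) auto
  moreover have "\<bar>ln (cmod (z - q)) - ln (cmod (p - q))\<bar> \<le> \<bar>cmod (z - q) - cmod (p - q)\<bar> / (c\<^sub>0 / 2)"
    using c zq by (intro abs_ln_diff_le) auto
  ultimately have 1: "\<bar>ln (cmod (z - q)) - ln (cmod (p - q))\<bar> \<le> 2 / c\<^sub>0 * \<epsilon>" by (simp add: mult.commute)
  have 2: "\<bar>arc_potential_at q \<eta> z - (ln 2 + ln (cmod (z - q)))\<bar> \<le> 64 / c\<^sub>0 ^ 4 * \<eta>"
    using arc_potential_at_far[OF q, of z "c\<^sub>0 / 2"] z c zq by (simp add: power_divide)
  have 3: "\<bar>arc_potential_at p \<epsilon> z - ln \<epsilon>\<bar> \<le> \<epsilon>" by (rule arc_potential_at_closed_arc[OF p z])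
  define X where "X = arc_potential_at p \<epsilon> z - ln \<epsilon>"
  define Y where "Y = arc_potential_at q \<eta> z - (ln 2 + ln (cmod (p - q)))"
  have Y: "\<bar>Y\<bar> \<le> 64 / c\<^sub>0 ^ 4 * \<eta> + 2 / c\<^sub>0 * \<epsilon>" unfolding Y_def using 1 2 by linarith
  have "\<bar>a * X + b * Y\<bar> \<le> \<bar>a * X\<bar> + \<bar>b * Y\<bar>" by (rule abs_triangle_ineq)
  also have "\<dots> \<le> 1 * \<bar>X\<bar> + 1 * \<bar>Y\<bar>"
    unfolding abs_mult using ab by (intro add_mono mult_right_mono) auto
  also have "\<dots> \<le> \<epsilon> + (64 / c\<^sub>0 ^ 4 * \<eta> + 2 / c\<^sub>0 * \<epsilon>)" using Y 3 by (simp add: X_def)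
  also have "\<dots> \<le> (1 + 64 / c\<^sub>0 ^ 4 + 2 / c\<^sub>0) * (\<epsilon> + \<eta>)"
  proof -
    have "0 \<le> 64 / c\<^sub>0 ^ 4 * \<epsilon>" "0 \<le> 2 / c\<^sub>0 * \<eta>" using c p q by auto
    then show ?thesis using q(2) unfolding distrib_left distrib_right by linarith
  qed
  also have "a * X + b * Y = a * arc_potential_at p \<epsilon> z + b * arc_potential_at q \<eta> z
      - (a * ln \<epsilon> + b * (ln 2 + ln (cmod (p - q))))"
    unfolding X_def Y_def right_diff_distrib by linarith
  finally show ?thesis .
qed

lemma two_arc_disk_asymptotics:
  fixes U :: "complex \<Rightarrow> real"
  assumes U: "continuous_on (cball 0 1) U" "\<And>z. cmod z < 1 \<Longrightarrow> has_laplacian_at U z (- 1)"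
    "\<And>z. cmod z = 1 \<Longrightarrow> z \<in> closed_arc p \<epsilon> \<union> closed_arc q \<eta> \<Longrightarrow> U z = 0"
    "\<And>z. cmod z = 1 \<Longrightarrow> z \<notin> closed_arc p \<epsilon> \<union> closed_arc q \<eta> \<Longrightarrow>
      ((\<lambda>h. U (z + of_real h * z)) has_real_derivative 0) (at 0 within {..0})"
    and p: "cmod p = 1" "0 < \<epsilon>" "\<epsilon> < 1" and q: "cmod q = 1" "0 < \<eta>" "\<eta> < 1"
    and c: "0 < c\<^sub>0" "c\<^sub>0 \<le> cmod (p - q)" "\<epsilon> \<le> c\<^sub>0 / 2" "\<eta> \<le> c\<^sub>0 / 2"
    and z: "cmod z \<le> 1" "0 < r" "r \<le> cmod (z - p)" "r \<le> cmod (z - q)"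
    and d: "d = cmod (p - q)" and D: "D = ln (\<epsilon> * \<eta> / (4 * d\<^sup>2))"
  shows "\<bar>U z - (((ln d)\<^sup>2 - ln (\<epsilon> / 2) * ln (\<eta> / 2)) / D + 1 / 4 * (1 - (cmod z)\<^sup>2)
           + ln (\<eta> / (2 * d)) / D * ln (cmod (z - p)) + ln (\<epsilon> / (2 * d)) / D * ln (cmod (z - q)))\<bar>
         \<le> (1 + 64 / c\<^sub>0 ^ 4 + 2 / c\<^sub>0 + 4 / r ^ 4) * (\<epsilon> + \<eta>)"
proof -
  have "d > 0" using c(1,2) unfolding d by linarith
  \<comment> \<open>The weights solve two linear equations: \<open>a + b = 1\<close>, forced by the
    Neumann condition, and equality of the leading values of the combined potential on the two
    arcs.\<close>
  define a where "a = ln (\<eta> / (2 * d)) / D"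
  define b where "b = ln (\<epsilon> / (2 * d)) / D"
  have D_eq: "D = ln (\<epsilon> / (2 * d)) + ln (\<eta> / (2 * d))"
    unfolding D using p q \<open>d > 0\<close> by (subst ln_mult_pos[symmetric]) (auto simp: power2_eq_square)
  \<comment> \<open>Both half-angles are at most \<open>d / 2\<close>. Equal signs put the weights
    in [0,1], so the errors are not amplified.\<close>
  have neg: "ln (\<epsilon> / (2 * d)) < 0" "ln (\<eta> / (2 * d)) < 0"
    using p q c \<open>d > 0\<close> unfolding d[symmetric] by (auto intro!: ln_less_zero)
  then have "D < 0" using D_eq by simp
  have ab: "a + b = 1" unfolding a_def b_def using D_eq \<open>D < 0\<close> by (simp add: add_divide_distrib[symmetric])
  have ab0: "0 \<le> a" "0 \<le> b" unfolding a_def b_def using neg \<open>D < 0\<close> by (auto intro!: divide_nonpos_neg)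
  then have ab1: "a \<le> 1" "b \<le> 1" using ab by auto
  have lns: "ln (\<epsilon> / (2 * d)) = ln \<epsilon> - (ln 2 + ln d)" "ln (\<eta> / (2 * d)) = ln \<eta> - (ln 2 + ln d)"
     "ln (\<epsilon> / 2) = ln \<epsilon> - ln 2" "ln (\<eta> / 2) = ln \<eta> - ln 2"
    using p q \<open>d > 0\<close> by (auto simp: ln_div ln_mult)
  \<comment> \<open>The common leading value on both arcs; \<open>C_eq\<close> is the same number
    seen from the arc around \<open>q\<close>.\<close>
  define C where "C = a * ln \<epsilon> + b * (ln 2 + ln d)"
  have ln_eqs: "ln \<epsilon> = b * D + (ln 2 + ln d)" "ln \<eta> = a * D + (ln 2 + ln d)"
    unfolding a_def b_def lns using \<open>D < 0\<close> by auto
  have C_eq: "C = b * ln \<eta> + a * (ln 2 + ln d)"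
    unfolding C_def ln_eqs by (simp add: algebra_simps)
  \<comment> \<open>Far away each potential is \<open>ln 2\<close> plus a logarithm of a distance,
    and \<open>a + b = 1\<close>; subtracting \<open>C\<close> to vanish on the arcs leaves this
    constant.\<close>
  have const: "((ln d)\<^sup>2 - ln (\<epsilon> / 2) * ln (\<eta> / 2)) / D = ln 2 - C"
  proof -
    have "(ln 2 - C) * D = (ln d)\<^sup>2 - ln (\<epsilon> / 2) * ln (\<eta> / 2)"
      using ab unfolding C_def lns ln_eqs by algebra
    then show ?thesis using \<open>D < 0\<close> by (simp add: field_simps)
  qed
  define P where "P = arc_potential_at p \<epsilon>"
  define Q where "Q = arc_potential_at q \<eta>"
  define M where "M = (1 + 64 / c\<^sub>0 ^ 4 + 2 / c\<^sub>0) * (\<epsilon> + \<eta>)"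
  \<comment> \<open>The solution minus its approximation: the quadratic term cancels the right-hand
    side -1, and its normal derivative 1/2 cancels that of the weighted potentials.\<close>
  define V where "V = (\<lambda>z. U z + ((1 / 4) * (cmod z)\<^sup>2 + ((- a) * P z + ((- b) * Q z + (C - 1 / 4)))))"
  \<comment> \<open>Laplacian 1/2 and normal derivative 1/4 - 1/2; any coefficient strictly between
    0 and 1/4 in place of 1/8 gives the right signs.\<close>
  define \<phi> where "\<phi> = (\<lambda>z. 1 / 8 * (cmod z)\<^sup>2 + (- 1) * P z)"
  let ?B = "closed_arc p \<epsilon> \<union> closed_arc q \<eta>"
  have contPQ: "continuous_on (cball 0 1) P" "continuous_on (cball 0 1) Q"
    unfolding P_def Q_def by (rule continuous_on_arc_potential_at p q)+
  have contV: "continuous_on (cball 0 1) V"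
    unfolding V_def by (intro continuous_intros U contPQ)
  have cont\<phi>: "continuous_on (cball 0 1) \<phi>"
    unfolding \<phi>_def by (intro continuous_intros contPQ)
  have lapPQ: "has_laplacian_at P w 0" "has_laplacian_at Q w 0" if "cmod w < 1" for w
    unfolding P_def Q_def by (rule has_laplacian_arc_potential_at p q that)+
  have lapV: "has_laplacian_at V w 0" if w: "cmod w < 1" for w
  proof -
    have "has_laplacian_at V w (- 1 + (1 / 4 * 4 + ((- a) * 0 + ((- b) * 0 + 0))))"
      unfolding V_def
      by (intro has_laplacian_at_add has_laplacian_at_cmult has_laplacian_at_const
          has_laplacian_at_cmod_square lapPQ w U)
    then show ?thesis by simp
  qed
  have lap\<phi>: "\<exists>L>0. has_laplacian_at \<phi> w L" if w: "cmod w < 1" for w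
  proof -
    have "has_laplacian_at \<phi> w (1 / 8 * 4 + (- 1) * 0)"
      unfolding \<phi>_def by (intro has_laplacian_at_add has_laplacian_at_cmult
          has_laplacian_at_cmod_square lapPQ w)
    then show ?thesis by (intro exI[of _ "1/2"]) simp
  qed
  have nP: "((\<lambda>h. P (w + of_real h * w)) has_real_derivative 1 / 2) (at 0 within {..0})"
    and nQ: "((\<lambda>h. Q (w + of_real h * w)) has_real_derivative 1 / 2) (at 0 within {..0})"
    and nS: "((\<lambda>h. (cmod (w + of_real h * w))\<^sup>2) has_real_derivative 2) (at 0 within {..0})"
    if w: "cmod w = 1" "w \<notin> ?B" for w
    unfolding P_def Q_def using w
    by (auto intro!: has_field_derivative_at_within[OF has_normal_derivative_arc_potential_at] p q
        has_field_derivative_at_within[OF has_normal_derivative_cmod_square])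
  have nV: "((\<lambda>h. V (w + of_real h * w)) has_real_derivative 0) (at 0 within {..0})"
    if w: "cmod w = 1" "w \<notin> ?B" for w
  proof -
    have "((\<lambda>h. V (w + of_real h * w)) has_real_derivative
        0 + (1 / 4 * 2 + ((- a) * (1 / 2) + ((- b) * (1 / 2) + 0)))) (at 0 within {..0})"
      unfolding V_def by (intro DERIV_add DERIV_cmult DERIV_const nP nQ nS w U)
    also have "0 + (1 / 4 * 2 + ((- a) * (1 / 2) + ((- b) * (1 / 2) + 0))) = 0"
      using ab by (simp add: field_simps)
    finally show ?thesis .
  qed
  have n\<phi>: "\<exists>E<0. ((\<lambda>h. \<phi> (w + of_real h * w)) has_real_derivative E) (at 0 within {..0})"
    if w: "cmod w = 1" "w \<notin> ?B" for w
  proof -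
    have "((\<lambda>h. \<phi> (w + of_real h * w)) has_real_derivative
        1 / 8 * 2 + (- 1) * (1 / 2)) (at 0 within {..0})"
      unfolding \<phi>_def by (intro DERIV_add DERIV_cmult nP nS w)
    then show ?thesis by (intro exI[of _ "- (1/4)"]) simp
  qed
  have bd: "\<bar>V w\<bar> \<le> M" if w: "cmod w = 1" "w \<in> ?B" for w
  proof -
    have V: "V w = - (a * P w + b * Q w - C)" using U(3)[OF w] w unfolding V_def by simp
    from w(2) show ?thesis
    proof
      assume "w \<in> closed_arc p \<epsilon>"
      from two_arc_potential_on_arc[OF p q w(1) this c(1,2,3) ab0(1) ab1(1) ab0(2) ab1(2)]
      show ?thesis unfolding V P_def Q_def C_def d M_def by simp
    next
      assume "w \<in> closed_arc q \<eta>"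
      from two_arc_potential_on_arc[OF q p w(1) this c(1) _ c(4) ab0(2) ab1(2) ab0(1) ab1(1)] c(2)
      show ?thesis unfolding V P_def Q_def C_eq d M_def by (simp add: norm_minus_commute add.commute)
    qed
  qed
  have le: "V z \<le> M"
    by (rule mixed_max_principle_neumann[where B = ?B and \<phi> = \<phi>])
       (use contV cont\<phi> lapV lap\<phi> nV n\<phi> bd z in \<open>auto simp: abs_le_iff\<close>)
  have ge: "- V z \<le> M"
  proof (rule mixed_max_principle_neumann[where B = ?B and \<phi> = \<phi>])
    show "continuous_on (cball 0 1) (\<lambda>z. - V z)" by (intro continuous_intros contV)
    show "has_laplacian_at (\<lambda>z. - V z) w 0" if "cmod w < 1" for w
      using has_laplacian_at_cmult[OF lapV[OF that], of "- 1"] by simp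
    show "((\<lambda>h. - V (w + of_real h * w)) has_real_derivative 0) (at 0 within {..0})"
      if "cmod w = 1" "w \<notin> ?B" for w
      using DERIV_minus[OF nV[OF that]] by simp
    show "- V w \<le> M" if "cmod w = 1" "w \<in> ?B" for w using bd[OF that] by (simp add: abs_le_iff)
  qed (use cont\<phi> lap\<phi> n\<phi> z in auto)
  define X where "X = P z - (ln 2 + ln (cmod (z - p)))"
  define Y where "Y = Q z - (ln 2 + ln (cmod (z - q)))"
  have X: "\<bar>X\<bar> \<le> 4 / r ^ 4 * \<epsilon>" unfolding X_def P_def by (rule arc_potential_at_far[OF p z(1,2,3)])
  have Y: "\<bar>Y\<bar> \<le> 4 / r ^ 4 * \<eta>" unfolding Y_def Q_def by (rule arc_potential_at_far[OF q z(1,2,4)])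
  have "\<bar>a * X + b * Y\<bar> \<le> \<bar>a * X\<bar> + \<bar>b * Y\<bar>" by (rule abs_triangle_ineq)
  also have "\<dots> \<le> 1 * \<bar>X\<bar> + 1 * \<bar>Y\<bar>"
    unfolding abs_mult using ab0 ab1 by (intro add_mono mult_right_mono) auto
  also have "\<dots> \<le> 4 / r ^ 4 * (\<epsilon> + \<eta>)" using X Y by (simp add: distrib_left)
  \<comment> \<open>The first error comes from the maximum principle, the second from replacing the
    potentials at \<open>z\<close> by logarithms.\<close>
  finally have "\<bar>V z + (a * X + b * Y)\<bar> \<le> M + 4 / r ^ 4 * (\<epsilon> + \<eta>)" using le ge by linarith
  moreover have "V z + (a * X + b * Y) = U z - (ln 2 - C + 1 / 4 * (1 - (cmod z)\<^sup>2)
      + a * ln (cmod (z - p)) + b * ln (cmod (z - q)))"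
    using ab unfolding V_def X_def Y_def by (simp add: algebra_simps) algebra
  ultimately show ?thesis
    unfolding const a_def[symmetric] b_def[symmetric] M_def by (simp add: distrib_right)
qed

subsection \<open>Transfer from the plane\<close>

definition plane_pt :: "complex \<Rightarrow> real^2" where
  "plane_pt z = vector [Re z, Im z]"

lemma plane_pt_nth [simp]: "plane_pt z $ 1 = Re z" "plane_pt z $ 2 = Im z"
  by (simp_all add: plane_pt_def)

lemma plane_pt_add: "plane_pt (w + z) = plane_pt w + plane_pt z"
  by (simp add: vec_eq_iff forall_2)

lemma plane_pt_diff: "plane_pt (w - z) = plane_pt w - plane_pt z"
  by (simp add: vec_eq_iff forall_2)

lemma plane_pt_of_real_mult: "plane_pt (of_real h * z) = h *\<^sub>R plane_pt z"
  by (simp add: vec_eq_iff forall_2)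

lemma norm_plane_pt: "norm (plane_pt z) = cmod z"
  by (simp add: norm_vec_def L2_set_def sum_2 cmod_def)

lemma inner_plane_pt: "plane_pt w \<bullet> plane_pt z = Re (w * cnj z)"
  by (simp add: inner_vec_def sum_2)

lemma plane_pt_surj: obtains z where "x = plane_pt z"
  by (rule that[of "Complex (x $ 1) (x $ 2)"]) (simp add: vec_eq_iff forall_2)

lemma continuous_on_plane_pt: "continuous_on S plane_pt"
  by (rule continuous_onI) (auto simp: dist_norm norm_plane_pt simp flip: plane_pt_diff)

lemma circle_pt_eq: "circle_pt t = plane_pt (cis t)"
  by (simp add: circle_pt_def plane_pt_def)

section \<open>Derivatives and arcs in complex coordinates\<close>

lemma has_real_derivative_partial_deriv:
  assumes "f differentiable (at (x + h *\<^sub>R b))"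
  shows "((\<lambda>t. f (x + t *\<^sub>R b)) has_real_derivative partial_deriv b f (x + h *\<^sub>R b)) (at h)"
proof -
  let ?F = "frechet_derivative f (at (x + h *\<^sub>R b))"
  have F: "(f has_derivative ?F) (at (x + h *\<^sub>R b))"
    using assms frechet_derivative_works by blast
  have "((\<lambda>t. x + t *\<^sub>R b) has_derivative (\<lambda>t. t *\<^sub>R b)) (at h)"
    by (auto intro!: derivative_eq_intros)
  from diff_chain_at[OF this F]
  have "((\<lambda>t. f (x + t *\<^sub>R b)) has_derivative (\<lambda>t. ?F (t *\<^sub>R b))) (at h)" by (simp add: o_def)
  also have "(\<lambda>t. ?F (t *\<^sub>R b)) = (*) (?F b)"
    using linear_scale[OF has_derivative_linear[OF F]] by (auto simp: mult.commute)
  finally show ?thesis unfolding has_field_derivative_def partial_deriv_def .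
qed

lemma C2_on_has_deriv2:
  assumes "C2_on S f" "open S" "x \<in> S" "b \<in> Basis"
  shows "has_deriv2_at_0 (\<lambda>h. f (x + h *\<^sub>R b)) (partial_deriv b (partial_deriv b f) x)"
proof -
  have diff: "y \<in> S \<Longrightarrow> f differentiable (at y)" "y \<in> S \<Longrightarrow> partial_deriv b f differentiable (at y)" for y
    using assms unfolding C2_on_def C1_on_def by auto
  have "((\<lambda>h. x + h *\<^sub>R b) \<longlongrightarrow> x + 0 *\<^sub>R b) (nhds 0)"
    by (intro tendsto_intros filterlim_ident)
  then have "\<forall>\<^sub>F h in nhds 0. x + h *\<^sub>R b \<in> S"
    using assms(2,3) by (auto dest: topological_tendstoD)
  then have ev: "\<forall>\<^sub>F h in nhds 0.
      ((\<lambda>t. f (x + t *\<^sub>R b)) has_real_derivative partial_deriv b f (x + h *\<^sub>R b)) (at h)"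
    by (rule eventually_mono) (intro has_real_derivative_partial_deriv diff)
  have "((\<lambda>t. partial_deriv b f (x + t *\<^sub>R b)) has_real_derivative
      partial_deriv b (partial_deriv b f) (x + 0 *\<^sub>R b)) (at 0)"
    using assms(3) by (intro has_real_derivative_partial_deriv diff) simp
  with ev show ?thesis unfolding has_deriv2_at_0_def
    by (intro exI[of _ "\<lambda>h. partial_deriv b f (x + h *\<^sub>R b)"]) simp
qed

text \<open>The two basis vectors are the images of 1 and \<open>\<i>\<close>, so the basis sum
  becomes the two directions of \<open>has_laplacian_at\<close>.\<close>

lemma C2_on_has_laplacian_at:
  fixes u :: "real^2 \<Rightarrow> real"
  assumes "C2_on S u" "open S" "plane_pt z \<in> S"
  shows "has_laplacian_at (\<lambda>z. u (plane_pt z)) z (laplacian u (plane_pt z))"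
proof -
  have ax: "axis 1 1 = plane_pt 1" "axis 2 1 = plane_pt \<i>"
    by (simp_all add: vec_eq_iff forall_2 axis_def)
  have "(Basis :: (real^2) set) = {plane_pt 1, plane_pt \<i>}"
    unfolding ax[symmetric] by (auto simp: Basis_vec_def UNIV_2)
  note B = this
  have "plane_pt 1 \<noteq> plane_pt \<i>" by (auto simp: vec_eq_iff forall_2)
  then have "laplacian u (plane_pt z) = partial_deriv (plane_pt 1) (partial_deriv (plane_pt 1) u) (plane_pt z)
      + partial_deriv (plane_pt \<i>) (partial_deriv (plane_pt \<i>) u) (plane_pt z)"
    "plane_pt 1 \<in> Basis" "plane_pt \<i> \<in> Basis"
    unfolding laplacian_def B by auto
  then show ?thesis
    using C2_on_has_deriv2[OF assms] unfolding has_laplacian_at_def plane_pt_add plane_pt_of_real_mult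
    by blast
qed

lemma boundary_arc_inner_ge:
  assumes "x \<in> boundary_arc s \<epsilon>" "\<epsilon> < 1"
  shows "cos \<epsilon> \<le> x \<bullet> circle_pt s"
proof -
  obtain t where t: "x = circle_pt t" "\<bar>t - s\<bar> < \<epsilon>"
    using assms(1) by (auto simp: boundary_arc_def)
  have "cos \<epsilon> \<le> cos \<bar>t - s\<bar>" using t(2) assms(2) pi_gt3 by (intro cos_monotone_0_pi_le) auto
  also have "cos \<bar>t - s\<bar> = circle_pt t \<bullet> circle_pt s"
    by (simp add: circle_pt_eq inner_plane_pt cos_diff)
  finally show ?thesis using t(1) by simp
qed

text \<open>Forwards, a closed half-plane contains the open arc. Backwards, the angle from the
  centre lies in the closed interval, and a continuous map sends the closure of an interval into the
  closure of its image.\<close>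

lemma plane_pt_in_closure_boundary_arc_iff:
  assumes z: "cmod z = 1" and \<epsilon>: "0 < \<epsilon>" "\<epsilon> < 1"
  shows "plane_pt z \<in> closure (boundary_arc s \<epsilon>) \<longleftrightarrow> z \<in> closed_arc (cis s) \<epsilon>"
proof
  assume *: "plane_pt z \<in> closure (boundary_arc s \<epsilon>)"
  have "closure (boundary_arc s \<epsilon>) \<subseteq> {x. cos \<epsilon> \<le> x \<bullet> circle_pt s}"
  proof (rule closure_minimal)
    show "boundary_arc s \<epsilon> \<subseteq> {x. cos \<epsilon> \<le> x \<bullet> circle_pt s}"
      using boundary_arc_inner_ge[OF _ \<epsilon>(2)] by auto
    show "closed {x. cos \<epsilon> \<le> x \<bullet> circle_pt s}" by (intro closed_Collect_le continuous_intros)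
  qed
  with * show "z \<in> closed_arc (cis s) \<epsilon>"
    by (auto simp: closed_arc_def circle_pt_eq inner_plane_pt)
next
  assume *: "z \<in> closed_arc (cis s) \<epsilon>"
  define \<theta> where "\<theta> = Arg (z * cnj (cis s))"
  have "cmod (z * cnj (cis s)) = 1" using z by (simp add: norm_mult)
  then have \<theta>: "z * cnj (cis s) = cis \<theta>"
    unfolding \<theta>_def by (metis cis_Arg norm_zero sgn_eq zero_neq_one div_by_1 of_real_1)
  have "\<bar>\<theta>\<bar> \<le> pi" unfolding \<theta>_def using Arg_bounded[of "z * cnj (cis s)"] by auto
  have "\<bar>\<theta>\<bar> \<le> \<epsilon>"
  proof (rule ccontr)
    assume "\<not> \<bar>\<theta>\<bar> \<le> \<epsilon>"
    then have "cos \<bar>\<theta>\<bar> < cos \<epsilon>" using \<epsilon> \<open>\<bar>\<theta>\<bar> \<le> pi\<close> by (intro cos_monotone_0_pi) auto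
    moreover have "cos \<epsilon> \<le> cos \<theta>" using * unfolding closed_arc_def mem_Collect_eq \<theta> by simp
    ultimately show False by simp
  qed
  have "z = cis (s + \<theta>)"
  proof -
    have "z * (cnj (cis s) * cis s) = cis \<theta> * cis s" using \<theta> by (simp add: mult.assoc[symmetric])
    then show ?thesis by (simp add: cis_cnj cis_mult add.commute)
  qed
  then have "plane_pt z = circle_pt (s + \<theta>)" by (simp add: circle_pt_eq)
  moreover have "s + \<theta> \<in> closure {s - \<epsilon> <..< s + \<epsilon>}" using \<open>\<bar>\<theta>\<bar> \<le> \<epsilon>\<close> \<epsilon> by auto
  moreover have "circle_pt ` closure {s - \<epsilon> <..< s + \<epsilon>} \<subseteq> closure (boundary_arc s \<epsilon>)"
  proof (rule image_closure_subset)
    have "continuous_on UNIV (\<lambda>t. plane_pt (cis t))"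
      by (rule continuous_on_compose2[OF continuous_on_plane_pt]) (auto intro!: continuous_intros)
    then show "continuous_on (closure {s - \<epsilon> <..< s + \<epsilon>}) circle_pt"
      unfolding circle_pt_eq[abs_def] by (rule continuous_on_subset) simp
  qed (auto simp: boundary_arc_def closure_subset[THEN subsetD])
  ultimately show "plane_pt z \<in> closure (boundary_arc s \<epsilon>)" by auto
qed

theorem theorem3p3:
  fixes c\<^sub>0 c :: real
  assumes "c\<^sub>0 > 0" and "c > 0"
  shows "\<exists>K>0. \<exists>\<delta>>0. \<forall>s\<^sub>1 s\<^sub>2 \<epsilon>\<^sub>1 \<epsilon>\<^sub>2 :: real. \<forall>u :: real^2 \<Rightarrow> real.
    0 < \<epsilon>\<^sub>1 \<and> \<epsilon>\<^sub>1 < \<delta> \<and> 0 < \<epsilon>\<^sub>2 \<and> \<epsilon>\<^sub>2 < \<delta> \<and>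
    closure (boundary_arc s\<^sub>1 \<epsilon>\<^sub>1) \<inter> closure (boundary_arc s\<^sub>2 \<epsilon>\<^sub>2) = {} \<and>
    c\<^sub>0 \<le> norm (circle_pt s\<^sub>1 - circle_pt s\<^sub>2) \<and>
    mixed_bvp_solution (boundary_arc s\<^sub>1 \<epsilon>\<^sub>1 \<union> boundary_arc s\<^sub>2 \<epsilon>\<^sub>2) u \<longrightarrow>
    (\<forall>x\<in>unit_disk. c \<le> infdist x (boundary_arc s\<^sub>1 \<epsilon>\<^sub>1 \<union> boundary_arc s\<^sub>2 \<epsilon>\<^sub>2) \<longrightarrow>
      (let d = norm (circle_pt s\<^sub>1 - circle_pt s\<^sub>2);
           D = ln (\<epsilon>\<^sub>1 * \<epsilon>\<^sub>2 / (4 * d\<^sup>2))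
       in \<bar>u x -
            (((ln d)\<^sup>2 - ln (\<epsilon>\<^sub>1 / 2) * ln (\<epsilon>\<^sub>2 / 2)) / D
             + 1 / 4 * (1 - (norm x)\<^sup>2)
             + ln (\<epsilon>\<^sub>2 / (2 * d)) / D * ln (norm (x - circle_pt s\<^sub>1))
             + ln (\<epsilon>\<^sub>1 / (2 * d)) / D * ln (norm (x - circle_pt s\<^sub>2)))\<bar>
          \<le> K * sqrt (\<epsilon>\<^sub>1\<^sup>2 + \<epsilon>\<^sub>2\<^sup>2)))"
proof -
  define K where "K = 1 + 64 / c\<^sub>0 ^ 4 + 2 / c\<^sub>0 + 4 / c ^ 4"
  have "K > 0" unfolding K_def using assms by (intro add_pos_pos) auto
  show ?thesis
  \<comment> \<open>The threshold supplies the conditions of the disk estimate, half-angles below 1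
    and at most \<open>c\<^sub>0 / 2\<close>. The factor 2 pays for passing from the sum of the
    half-angles to the square root.\<close>
  proof (rule exI[of _ "K * 2"], rule conjI, use \<open>K > 0\<close> in simp,
         rule exI[of _ "min 1 (c\<^sub>0 / 2)"], rule conjI, use assms in simp, intro allI impI ballI, elim conjE)
    fix s\<^sub>1 s\<^sub>2 \<epsilon>\<^sub>1 \<epsilon>\<^sub>2 :: real and u :: "real^2 \<Rightarrow> real" and x :: "real^2"
    let ?A = "boundary_arc s\<^sub>1 \<epsilon>\<^sub>1 \<union> boundary_arc s\<^sub>2 \<epsilon>\<^sub>2"
    let ?p = "cis s\<^sub>1" and ?q = "cis s\<^sub>2"
    assume x: "x \<in> unit_disk" "c \<le> infdist x ?A"
      and e1: "0 < \<epsilon>\<^sub>1" "\<epsilon>\<^sub>1 < min 1 (c\<^sub>0 / 2)" and e2: "0 < \<epsilon>\<^sub>2" "\<epsilon>\<^sub>2 < min 1 (c\<^sub>0 / 2)"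
      and c0: "c\<^sub>0 \<le> norm (circle_pt s\<^sub>1 - circle_pt s\<^sub>2)"
      and "mixed_bvp_solution ?A u"
    then have u: "continuous_on (closure unit_disk) u" "C2_on unit_disk u"
      "\<And>x. x \<in> unit_disk \<Longrightarrow> laplacian u x = - 1" "\<And>x. x \<in> ?A \<Longrightarrow> u x = 0"
      "\<And>x. x \<in> frontier unit_disk - closure ?A \<Longrightarrow> has_normal_deriv u x 0 x"
      unfolding mixed_bvp_solution_def by auto
    obtain z where z: "x = plane_pt z" by (rule plane_pt_surj)
    define U where "U = (\<lambda>z. u (plane_pt z))"
    have iff: "plane_pt w \<in> closure ?A \<longleftrightarrow> w \<in> closed_arc ?p \<epsilon>\<^sub>1 \<union> closed_arc ?q \<epsilon>\<^sub>2"
      if "cmod w = 1" for w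
      using plane_pt_in_closure_boundary_arc_iff[OF that] e1 e2 by auto
    have "?A \<subseteq> closure unit_disk"
      by (auto simp: boundary_arc_def unit_disk_def circle_pt_eq norm_plane_pt)
    then have sub: "closure ?A \<subseteq> closure unit_disk" by (simp add: closure_minimal)
    \<comment> \<open>The boundary condition is given on open arcs only; continuity extends it to
      the end points, which belong to \<open>closed_arc\<close>.\<close>
    have zero: "u y = 0" if "y \<in> closure ?A" for y
      using continuous_constant_on_closure[OF continuous_on_subset[OF u(1) sub] u(4) that] .
    \<comment> \<open>Used for the two centres, each of which lies on its own arc.\<close>
    have dist: "c \<le> norm (x - circle_pt t)" if "circle_pt t \<in> ?A" for t
      using infdist_le[OF that, of x] x(2) by (simp add: dist_norm)
    have "\<bar>U z - (((ln (cmod (?p - ?q)))\<^sup>2 - ln (\<epsilon>\<^sub>1 / 2) * ln (\<epsilon>\<^sub>2 / 2)) / ln (\<epsilon>\<^sub>1 * \<epsilon>\<^sub>2 / (4 * (cmod (?p - ?q))\<^sup>2))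
        + 1 / 4 * (1 - (cmod z)\<^sup>2)
        + ln (\<epsilon>\<^sub>2 / (2 * cmod (?p - ?q))) / ln (\<epsilon>\<^sub>1 * \<epsilon>\<^sub>2 / (4 * (cmod (?p - ?q))\<^sup>2)) * ln (cmod (z - ?p))
        + ln (\<epsilon>\<^sub>1 / (2 * cmod (?p - ?q))) / ln (\<epsilon>\<^sub>1 * \<epsilon>\<^sub>2 / (4 * (cmod (?p - ?q))\<^sup>2)) * ln (cmod (z - ?q)))\<bar>
        \<le> K * (\<epsilon>\<^sub>1 + \<epsilon>\<^sub>2)"
      unfolding K_def
    proof (rule two_arc_disk_asymptotics[OF _ _ _ _ _ _ _ _ _ _ _ _ _ _ _ _ _ _ refl refl])
      show "continuous_on (cball 0 1) U" unfolding U_def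
        by (rule continuous_on_compose2[OF u(1) continuous_on_plane_pt])
           (auto simp: unit_disk_def norm_plane_pt)
      show "has_laplacian_at U w (- 1)" if "cmod w < 1" for w
        using C2_on_has_laplacian_at[OF u(2), of w] u(3)[of "plane_pt w"] that
        by (simp add: U_def unit_disk_def norm_plane_pt)
      show "U w = 0" if "cmod w = 1" "w \<in> closed_arc ?p \<epsilon>\<^sub>1 \<union> closed_arc ?q \<epsilon>\<^sub>2" for w
        unfolding U_def using zero iff that by blast
      show "((\<lambda>h. U (w + of_real h * w)) has_real_derivative 0) (at 0 within {..0})"
        if w: "cmod w = 1" "w \<notin> closed_arc ?p \<epsilon>\<^sub>1 \<union> closed_arc ?q \<epsilon>\<^sub>2" for w
      proof -
        have "plane_pt w \<in> frontier unit_disk - closure ?A"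
          using w iff by (auto simp: unit_disk_def norm_plane_pt)
        then show ?thesis
          using u(5) unfolding has_normal_deriv_def U_def plane_pt_add plane_pt_of_real_mult by blast
      qed
      show "c\<^sub>0 \<le> cmod (?p - ?q)"
        using c0 by (simp add: circle_pt_eq norm_plane_pt flip: plane_pt_diff)
      show "cmod z \<le> 1" using x(1) by (simp add: z unit_disk_def norm_plane_pt)
      show "c \<le> cmod (z - ?p)" "c \<le> cmod (z - ?q)"
        using dist[of s\<^sub>1] dist[of s\<^sub>2] e1 e2
        by (auto simp: boundary_arc_def z circle_pt_eq norm_plane_pt simp flip: plane_pt_diff)
    qed (use e1 e2 assms in auto)
    also have "K * (\<epsilon>\<^sub>1 + \<epsilon>\<^sub>2) \<le> K * (2 * sqrt (\<epsilon>\<^sub>1\<^sup>2 + \<epsilon>\<^sub>2\<^sup>2))"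
    proof (rule mult_left_mono)
      have "\<epsilon>\<^sub>1 \<le> sqrt (\<epsilon>\<^sub>1\<^sup>2 + \<epsilon>\<^sub>2\<^sup>2)" "\<epsilon>\<^sub>2 \<le> sqrt (\<epsilon>\<^sub>1\<^sup>2 + \<epsilon>\<^sub>2\<^sup>2)" by (auto intro!: real_le_rsqrt)
      then show "\<epsilon>\<^sub>1 + \<epsilon>\<^sub>2 \<le> 2 * sqrt (\<epsilon>\<^sub>1\<^sup>2 + \<epsilon>\<^sub>2\<^sup>2)" by linarith
    qed (use \<open>K > 0\<close> in simp)
    finally show "let d = norm (circle_pt s\<^sub>1 - circle_pt s\<^sub>2);
           D = ln (\<epsilon>\<^sub>1 * \<epsilon>\<^sub>2 / (4 * d\<^sup>2))
       in \<bar>u x -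
            (((ln d)\<^sup>2 - ln (\<epsilon>\<^sub>1 / 2) * ln (\<epsilon>\<^sub>2 / 2)) / D
             + 1 / 4 * (1 - (norm x)\<^sup>2)
             + ln (\<epsilon>\<^sub>2 / (2 * d)) / D * ln (norm (x - circle_pt s\<^sub>1))
             + ln (\<epsilon>\<^sub>1 / (2 * d)) / D * ln (norm (x - circle_pt s\<^sub>2)))\<bar>
          \<le> K * 2 * sqrt (\<epsilon>\<^sub>1\<^sup>2 + \<epsilon>\<^sub>2\<^sup>2)"
      unfolding Let_def z U_def circle_pt_eq norm_plane_pt plane_pt_diff[symmetric]
      by (simp only: mult.assoc)
  qed
qed

end
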